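(* For every complex $z\in\mathbb{C}\setminus(-\infty,0]$ we have $$B_{n}(z)\sim \frac{\left(1+\sqrt{z}+\sqrt{z+\sqrt{z}}\right)^2}{2\left(2\pi n\sqrt{z+\sqrt{z}}\right)^{3/2}}\left(1+2\sqrt{z}+2\sqrt{z+\sqrt{z}}\right)^{2n},\qquad n\to\infty .$$ In particular, $$B_{n}(1)\sim \frac{(1+\sqrt{2})^2}{(2\pi\sqrt{2}\,n)^{3/2}}(1+\sqrt{2})^{4n},\qquad n\to\infty .$$
   Context: The Apéry polynomials are $B_n(z)=\sum_{k=0}^n\binom{n}{k}^2\binom{n+k}{k}^2z^k$. For complex sequences, $a_n\sim b_n$ as $n\to\infty$ means $a_n/b_n\to1$. All roots take their principal value: $\sqrt{z}=\exp\{\frac12(\log|z|+i\arg(z))\}$ with $\arg(z)\in(-\pi,\pi)$ for $z\in\mathbb{C}\setminus(-\infty,0]$. The power $3/2$ is likewise the principal one, $u^{3/2}=\exp\{\frac32(\log|u|+i\arg(u))\}$ with $\arg(u)\in(-\pi,\pi)$. *)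

theory Defs
  imports "HOL-Analysis.Analysis" "HOL-Library.Landau_Symbols"
begin

definition apery_poly :: "nat \<Rightarrow> complex poly" where
  "apery_poly n =
     (\<Sum>k\<le>n. monom (of_nat ((n choose k)\<^sup>2 * ((n + k) choose k)\<^sup>2)) k)"

end

theory Submission
  imports Defs "HOL-Probability.Distributions" "HOL-Real_Asymp.Real_Asymp"
begin

text \<open>
  Write \<open>w = csqrt z\<close>, so that \<open>Re w > 0\<close>, and let \<open>p_n(u)\<close> be the polynomial with coefficients
  \<open>binom(n, k) * binom(n + k, k)\<close>, i.e. the Legendre polynomial \<open>P_n(1 + 2u)\<close>. The Apery polynomial
  has the squares of these coefficients, so by Parseval (lemma \<open>apery_integral\<close>)
  \<open>B_n(w\<^sup>2)\<close> is the mean of \<open>p_n(w * exp (\<i>x)) * p_n(w * exp (-\<i>x))\<close> over \<open>-pi \<le> x \<le> pi\<close>, and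
  Laplace's method applies at \<open>x = 0\<close>.

  Locally, \<open>p_n(u)\<close> behaves like \<open>g(u) ^ n / sqrt (pi * n * (1 - 1 / g(u)\<^sup>2))\<close> with
  \<open>g(u) = 1 + 2u + 2 * csqrt (u\<^sup>2 + u)\<close>. This comes from writing \<open>p_n\<close> as a convolution of central
  binomial weights times powers of \<open>g\<close> (\<open>legendre_eq_sum_cbw\<close>) and Tannery's theorem
  (\<open>legendre_asymptotic\<close>). The second derivative of \<open>Ln (g(w * exp (\<i>x)))\<close> at \<open>0\<close> supplies the
  exponent of the limiting Gaussian (\<open>phase_limit\<close>).

  Globally, one must exclude other contributions on the circle, although \<open>w\<close> is complex and the integrand
  oscillates. The modulus of \<open>p_n(u)\<close> is at most \<open>growth u ^ n\<close>, where \<open>growth u\<close> depends only on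
  \<open>norm u + norm (u + 1)\<close>. On the circle \<open>norm u = norm w\<close> its logarithm is a concave increasing function of
  \<open>Re u\<close> (\<open>growth_le_exp_Re\<close>). The points \<open>w * exp (\<i>x)\<close> and \<open>w * exp (-\<i>x)\<close> have average real part
  \<open>Re w * cos x\<close>, so the product of their growth rates is largest at \<open>x = 0\<close> precisely because
  \<open>Re w > 0\<close>, with a quadratic loss in \<open>x\<close> (\<open>growth_product_decay\<close>). That is where the
  exclusion of the negative axis for \<open>z\<close> enters. Dominated convergence then gives the limit
  (\<open>apery_poly_limit\<close>), and comparing arguments of the principal roots puts the constant into the
  stated form (\<open>apery_limit_const_eq\<close>).
\<close>

section \<open>Normalized central binomial coefficients\<close>

text \<open>
  The central binomial weight \<open>binom(2n, n) / 4^n\<close>. In Pochhammer form both the two-term recurrence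
  and the link to the binomial series of \<open>(1 - h) powr (-1/2)\<close> are immediate.
\<close>

definition cbw :: "nat \<Rightarrow> real" where
  "cbw n = pochhammer (1/2) n / fact n"

lemma cbw_0 [simp]: "cbw 0 = 1"
  by (simp add: cbw_def)

lemma cbw_Suc: "2 * (real n + 1) * cbw (Suc n) = (2 * real n + 1) * cbw n"
proof -
  have "cbw (Suc n) = cbw n * ((1/2 + real n) / (real n + 1))"
    by (simp add: cbw_def pochhammer_Suc mult_ac add_ac)
  thus ?thesis by (simp add: divide_simps) (simp add: algebra_simps)
qed

lemma cbw_pos: "cbw n > 0"
  by (simp add: cbw_def pochhammer_pos)

text \<open>
  Squaring removes the root from the induction: \<open>(cbw n)\<^sup>2 * (n + 1)\<close> is nonincreasing and starts at \<open>1\<close>.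
\<close>

lemma cbw_upper: "cbw n \<le> 1 / sqrt (real n + 1)"
proof -
  have "(cbw n)\<^sup>2 * (real n + 1) \<le> 1"
  proof (induction n)
    case (Suc n)
    have e: "cbw (Suc n) = (2 * real n + 1) / (2 * (real n + 1)) * cbw n"
      using cbw_Suc[of n] by (simp add: field_simps)
    have "((2 * real n + 1) / (2 * (real n + 1)))\<^sup>2 * (real n + 2) \<le> real n + 1"
    proof -
      have "(2 * real n + 1)\<^sup>2 * (real n + 2) \<le> (real n + 1) * (2 * (real n + 1))\<^sup>2"
        by (simp add: power2_eq_square algebra_simps)
      thus ?thesis by (simp add: power_divide divide_le_eq)
    qed
    hence *: "(cbw n)\<^sup>2 * (((2 * real n + 1) / (2 * (real n + 1)))\<^sup>2 * (real n + 2)) \<le> (cbw n)\<^sup>2 * (real n + 1)"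
      by (intro mult_left_mono) auto
    have "(cbw (Suc n))\<^sup>2 * (real (Suc n) + 1) =
      (cbw n)\<^sup>2 * (((2 * real n + 1) / (2 * (real n + 1)))\<^sup>2 * (real n + 2))"
      unfolding e power_mult_distrib by (simp add: mult_ac add_ac)
    with * Suc show ?case by linarith
  qed simp
  hence "(cbw n)\<^sup>2 \<le> (1 / sqrt (real n + 1))\<^sup>2"
    by (simp add: power_divide field_simps)
  thus ?thesis by (rule power2_le_imp_le) auto
qed

lemma cbw_le_1: "cbw n \<le> 1"
  using cbw_upper[of n] by (rule order_trans) (simp add: real_sqrt_ge_1_iff)

text \<open>
  Up to the factor \<open>n / (n + 1/2)\<close> the sequence is the defining sequence of \<open>1 / Gamma (1/2)\<close>.
\<close>

lemma cbw_asymp: "(\<lambda>n. sqrt (real n) * cbw n) \<longlonglongrightarrow> 1 / sqrt pi"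
proof -
  have "(\<lambda>n. rGamma_series (1/2 :: real) n * (real n / (real n + 1/2))) \<longlonglongrightarrow> rGamma (1/2) * 1"
    by (intro tendsto_mult rGamma_series_LIMSEQ) real_asymp
  moreover have "rGamma (1/2 :: real) = 1 / sqrt pi"
    using Gamma_one_half_real by (simp add: rGamma_inverse_Gamma field_simps)
  moreover have "eventually (\<lambda>n. rGamma_series (1/2 :: real) n * (real n / (real n + 1/2))
     = sqrt (real n) * cbw n) sequentially"
    using eventually_gt_at_top[of 0]
  proof eventually_elim
    case (elim n)
    have "exp (1/2 * ln (real n)) = sqrt (real n)"
      using elim by (simp add: powr_half_sqrt[symmetric] powr_def)
    hence "rGamma_series (1/2 :: real) n = cbw n * (real n + 1/2) / sqrt (real n)"
      by (simp add: rGamma_series_def cbw_def pochhammer_Suc mult_ac add_ac)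
    hence "rGamma_series (1/2 :: real) n * (real n / (real n + 1/2)) = cbw n * (real n / sqrt (real n))"
      using elim by simp
    also have "real n / sqrt (real n) = sqrt (real n)" by (rule real_div_sqrt) simp
    finally show ?case by (simp add: mult.commute)
  qed
  ultimately show ?thesis by (simp add: tendsto_cong)
qed

lemma cbw_sums:
  fixes h :: complex
  assumes "norm h < 1"
  shows "(\<lambda>n. of_real (cbw n) * h ^ n) sums ((1 - h) powr (-1/2))"
proof -
  have "((-1/2) gchoose n) * (-h) ^ n = of_real (cbw n) * h ^ n" for n
  proof -
    have "pochhammer (1/2 :: complex) n = of_real (pochhammer (1/2) n)"
      using pochhammer_of_real[of "1/2" n, where 'a = complex] by simp
    thus ?thesis
      by (simp add: gbinomial_pochhammer cbw_def power_minus[of h])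
  qed
  with gen_binomial_complex[of "-h" "-1/2"] assms show ?thesis by simp
qed

section \<open>Shifted Legendre polynomials\<close>

text \<open>
  This is the Legendre polynomial \<open>P_n(1 + 2u)\<close>. Its coefficients are the square roots of those of the
  Apery polynomial.
\<close>

definition shifted_legendre :: "nat \<Rightarrow> complex \<Rightarrow> complex" where
  "shifted_legendre n u = (\<Sum>k\<le>n. of_nat ((n choose k) * ((n + k) choose k)) * u ^ k)"

text \<open>
  Bonnet's recurrence. It holds coefficientwise: writing \<open>a n k\<close> for the \<open>k\<close>-th coefficient, the ratios
  \<open>a n (k+1) / a n k\<close> and \<open>a (n+1) k / a n k\<close> are rational in \<open>n\<close> and \<open>k\<close>, so each coefficient
  identity reduces to a polynomial identity after division by \<open>a n j\<close>; only the top coefficient, where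
  \<open>a n j\<close> vanishes, needs separate treatment.
\<close>

lemma legendre_rec:
  "of_nat (n + 2) * shifted_legendre (n + 2) u =
     of_nat (2 * n + 3) * (1 + 2 * u) * shifted_legendre (n + 1) u - of_nat (n + 1) * shifted_legendre n u"
proof -
  define a where "a = (\<lambda>n k. of_nat ((n choose k) * ((n + k) choose k)) :: complex)"
  have a_Suc_k: "a n (Suc j) * of_nat (j + 1) ^ 2 = a n j * of_nat (n + j + 1) * (of_nat n - of_nat j)"
    if "j \<le> n" for n j
  proof -
    have 1: "(n choose Suc j) * Suc j = (n choose j) * (n - j)"
      using binomial_absorption[of j n] binomial_absorb_comp[of n j] by (simp add: mult.commute)
    have 2: "((n + Suc j) choose Suc j) * Suc j = ((n + j) choose j) * (n + j + 1)"
      using Suc_times_binomial_eq[of "n + j" j] by (simp add: mult.commute)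
    have "(n choose Suc j) * Suc j * (((n + Suc j) choose Suc j) * Suc j) =
          (n choose j) * (n - j) * (((n + j) choose j) * (n + j + 1))"
      by (simp only: 1 2)
    hence "of_nat ((n choose Suc j) * Suc j * (((n + Suc j) choose Suc j) * Suc j)) =
          (of_nat ((n choose j) * (n - j) * (((n + j) choose j) * (n + j + 1))) :: complex)"
      by (simp only:)
    thus ?thesis using that
      by (simp add: a_def of_nat_diff power2_eq_square) (simp add: algebra_simps)
  qed
  have a_Suc_n: "a (Suc n) j * (of_nat n + 1 - of_nat j) = a n j * of_nat (n + 1 + j)"
    if "j \<le> n" for n j
  proof -
    have 1: "(Suc n choose j) * (Suc n - j) = (n choose j) * Suc n"
      using binomial_absorb_comp[of "Suc n" j] by (simp add: mult.commute)
    have 2: "((Suc n + j) choose j) * Suc n = ((n + j) choose j) * (n + 1 + j)"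
      using binomial_absorb_comp[of "Suc n + j" j] by (simp add: mult.commute)
    have "(Suc n choose j) * (Suc n - j) * (((Suc n + j) choose j) * Suc n)
          = (n choose j) * Suc n * (((n + j) choose j) * (n + 1 + j))"
      by (simp only: 1 2)
    hence "(Suc n choose j) * (Suc n - j) * (((Suc n + j) choose j))
          = (n choose j) * (((n + j) choose j) * (n + 1 + j))"
      by (metis (no_types, lifting) mult.assoc mult.commute mult_cancel2 nat.distinct(1))
    hence "of_nat ((Suc n choose j) * (Suc n - j) * (((Suc n + j) choose j)))
          = (of_nat ((n choose j) * (((n + j) choose j) * (n + 1 + j))) :: complex)"
      by (simp only:)
    thus ?thesis using that
      by (simp add: a_def of_nat_diff) (simp add: algebra_simps)
  qed
  have coeff: "of_nat (n + 2) * a (n + 2) (Suc j) =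
      of_nat (2 * n + 3) * (a (n + 1) (Suc j) + 2 * a (n + 1) j) - of_nat (n + 1) * a n (Suc j)"
    if "j \<le> n + 1" for j
  proof (cases "j \<le> n")
    case True
    define N J where "N = (of_nat n :: complex)" and "J = (of_nat j :: complex)"
    have nz: "N + 1 - J \<noteq> 0" "N + 2 - J \<noteq> 0" "J + 1 \<noteq> 0"
    proof -
      have *: "N + 1 - J = of_nat (n + 1 - j)" "N + 2 - J = of_nat (n + 2 - j)" "J + 1 = of_nat (j + 1)"
        using True by (simp_all add: N_def J_def of_nat_diff)
      show "N + 1 - J \<noteq> 0" "N + 2 - J \<noteq> 0" "J + 1 \<noteq> 0"
        unfolding * of_nat_eq_0_iff using True by auto
    qed
    define A where "A = a n j"
    have A1: "a (n+1) j = A * (N + 1 + J) / (N + 1 - J)"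
      using a_Suc_n[OF True] nz by (simp add: A_def N_def J_def field_simps)
    have A2: "a (n+2) j = a (n+1) j * (N + 2 + J) / (N + 2 - J)"
      using a_Suc_n[of j "n+1"] True nz by (simp add: N_def J_def field_simps)
    have B0: "a n (Suc j) = A * (N + J + 1) * (N - J) / (J + 1)^2"
      using a_Suc_k[OF True] nz by (simp add: A_def N_def J_def field_simps)
    have B1: "a (n+1) (Suc j) = a (n+1) j * (N + J + 2) * (N + 1 - J) / (J + 1)^2"
      using a_Suc_k[of j "n+1"] True nz by (simp add: N_def J_def field_simps)
    have B2: "a (n+2) (Suc j) = a (n+2) j * (N + J + 3) * (N + 2 - J) / (J + 1)^2"
      using a_Suc_k[of j "n+2"] True nz by (simp add: N_def J_def field_simps)
    have C1: "a (n+1) (Suc j) = A * (N + 1 + J) * (N + J + 2) / (J + 1)^2"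
      unfolding B1 A1 using nz by simp
    have C2: "a (n+2) (Suc j) = A * (N + 1 + J) / (N + 1 - J) * (N + 2 + J) * (N + J + 3) / (J + 1)^2"
      unfolding B2 A2 A1 using nz by simp
    have N: "of_nat (n + 2) = N + 2" "of_nat (2 * n + 3) = 2 * N + 3" "of_nat (n + 1) = N + 1"
      by (simp_all add: N_def)
    \<comment> \<open>All four coefficients become polynomial multiples of one common quantity.\<close>
    define d where "d = A / ((N+1-J) * (J+1)^2)"
    have scale: "K * (d * X) = L * (d * Y + 2 * (d * Y')) - M * (d * Z)"
      if "K * X = L * (Y + 2 * Y') - M * Z" for K L M X Y Y' Z :: complex
      using arg_cong[OF that, of "\<lambda>v. d * v"] by (simp add: algebra_simps)
    have D2: "a (n + 2) (Suc j) = d * ((N+1+J)*(N+2+J)*(N+J+3))"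
      unfolding C2 by (simp add: d_def)
    have D1: "a (n + 1) (Suc j) = d * ((N+1+J)*(N+J+2)*(N+1-J))"
      unfolding C1 using nz by (simp add: d_def)
    have D1': "a (n + 1) j = d * ((N+1+J)*(J+1)^2)"
      unfolding A1 using nz by (simp add: d_def)
    have D0: "a n (Suc j) = d * ((N+J+1)*(N-J)*(N+1-J))"
      unfolding B0 using nz by (simp add: d_def)
    show ?thesis unfolding N D2 D1 D1' D0
      by (rule scale) (simp add: algebra_simps power2_eq_square)
  next
    case False
    with that have j: "j = n + 1" by simp
    have z: "a (n + 1) (Suc j) = 0" "a n (Suc j) = 0" by (simp_all add: a_def j binomial_eq_0 del: binomial_Suc_Suc)
    have "a (n + 2) j * 1 = a (n + 1) j * of_nat (2 * n + 3)"
      using a_Suc_n[of j "n + 1"] by (simp add: j algebra_simps)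
    moreover have "a (n + 2) (Suc j) * of_nat (n + 2)^2 = a (n + 2) j * of_nat (2 * n + 4) * 1"
      using a_Suc_k[of j "n + 2"] by (simp add: j algebra_simps)
    ultimately have "of_nat (n + 2) * (of_nat (n + 2) * a (n + 2) (Suc j))
        = of_nat (n + 2) * (of_nat (2 * n + 3) * 2 * a (n + 1) j)"
      by (simp add: power2_eq_square algebra_simps)
    hence "of_nat (n + 2) * a (n + 2) (Suc j) = of_nat (2 * n + 3) * 2 * a (n + 1) j"
      by (subst (asm) mult_cancel_left) (simp only: of_nat_eq_0_iff, simp)
    thus ?thesis using z by simp
  qed
  have a0: "a m 0 = 1" for m by (simp add: a_def)
  have leg: "shifted_legendre m u = 1 + u * (\<Sum>j\<le>n+1. a m (Suc j) * u ^ j)" if "m \<le> n + 2" for m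
  proof -
    have "shifted_legendre m u = (\<Sum>k\<le>m. a m k * u ^ k)" by (simp add: shifted_legendre_def a_def)
    also have "\<dots> = (\<Sum>k\<le>Suc (n + 1). a m k * u ^ k)"
      using that by (intro sum.mono_neutral_left) (auto simp: a_def)
    also have "\<dots> = 1 + u * (\<Sum>j\<le>n+1. a m (Suc j) * u ^ j)"
      unfolding sum.atMost_Suc_shift
      by (simp only: a0 sum_distrib_left power_Suc power_0 mult_1_left mult_1_right mult.left_commute)
    finally show ?thesis .
  qed
  have leg': "shifted_legendre (n + 1) u = (\<Sum>j\<le>n+1. a (n + 1) j * u ^ j)"
    by (simp add: shifted_legendre_def a_def)
  have "of_nat (n + 2) * (\<Sum>j\<le>n+1. a (n + 2) (Suc j) * u ^ j) =
     of_nat (2 * n + 3) * ((\<Sum>j\<le>n+1. a (n + 1) (Suc j) * u ^ j) + 2 * (\<Sum>j\<le>n+1. a (n + 1) j * u ^ j))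
     - of_nat (n + 1) * (\<Sum>j\<le>n+1. a n (Suc j) * u ^ j)"
  proof -
    have "of_nat (n + 2) * (\<Sum>j\<le>n+1. a (n + 2) (Suc j) * u ^ j) =
       (\<Sum>j\<le>n+1. (of_nat (n + 2) * a (n + 2) (Suc j)) * u ^ j)"
      by (simp only: sum_distrib_left mult.assoc)
    also have "\<dots> = (\<Sum>j\<le>n+1. (of_nat (2 * n + 3) * (a (n + 1) (Suc j) + 2 * a (n + 1) j)
         - of_nat (n + 1) * a n (Suc j)) * u ^ j)"
      by (intro sum.cong refl) (simp only: coeff atMost_iff)
    also have "\<dots> = (\<Sum>j\<le>n+1. of_nat (2 * n + 3) * (a (n + 1) (Suc j) * u ^ j + 2 * (a (n + 1) j * u ^ j))
         - of_nat (n + 1) * (a n (Suc j) * u ^ j))"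
      by (intro sum.cong refl) (simp only: ring_distribs mult.assoc)
    finally show ?thesis
      by (simp only: sum_subtractf sum.distrib sum_distrib_left[symmetric])
  qed
  hence "u * (of_nat (n + 2) * (\<Sum>j\<le>n+1. a (n + 2) (Suc j) * u ^ j)) =
     u * (of_nat (2 * n + 3) * ((\<Sum>j\<le>n+1. a (n + 1) (Suc j) * u ^ j) + 2 * (\<Sum>j\<le>n+1. a (n + 1) j * u ^ j))
     - of_nat (n + 1) * (\<Sum>j\<le>n+1. a n (Suc j) * u ^ j))"
    by (simp only:)
  hence "of_nat (n + 2) * (shifted_legendre (n + 2) u - 1) =
     of_nat (2 * n + 3) * ((shifted_legendre (n + 1) u - 1) + 2 * u * shifted_legendre (n + 1) u)
     - of_nat (n + 1) * (shifted_legendre n u - 1)"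
    unfolding leg'[symmetric]
    by (subst (1 2) leg, simp, simp, subst leg[of n], simp) (simp add: algebra_simps)
  thus ?thesis by (simp add: algebra_simps)
qed

text \<open>
  The generating function of the Legendre polynomials is \<open>(1 - (x+y)t + t\<^sup>2) powr (-1/2)\<close>, and it factors
  as \<open>(1 - xt) powr (-1/2) * (1 - yt) powr (-1/2)\<close> if \<open>xy = 1\<close>; the claim is the Cauchy product of the
  two binomial series. Since this product satisfies a first-order linear differential equation, its
  coefficients obey the same recurrence as the polynomials themselves.

  The point of this form is that for \<open>norm x > 1\<close> the term \<open>x ^ n\<close> dominates and the remaining sum
  converges after multiplication by \<open>sqrt n\<close>.
\<close>

lemma legendre_eq_sum_cbw:
  assumes "x * y = 1" "x + y = 2 + 4 * u"
  shows "shifted_legendre n u = (\<Sum>k\<le>n. of_real (cbw k * cbw (n - k)) * x ^ (n - k) * y ^ k)"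
proof -
  define A :: "complex \<Rightarrow> complex fps" where "A = (\<lambda>x. Abs_fps (\<lambda>n. of_real (cbw n) * x ^ n))"
  define R where "R = (\<lambda>n. \<Sum>k\<le>n. of_real (cbw k * cbw (n - k)) * x ^ (n - k) * y ^ k)"
  define f where "f = A y * A x"
  have R_nth: "R n = fps_nth f n" for n
    unfolding f_def fps_mult_nth A_def R_def atLeast0AtMost
    by (intro sum.cong) (simp_all add: mult_ac)
  have cbw': "2 * (of_nat n + 1) * complex_of_real (cbw (Suc n)) = (2 * of_nat n + 1) * of_real (cbw n)" for n
    using arg_cong[OF cbw_Suc[of n], of complex_of_real] by simp
  have A_deriv: "2 * (1 - fps_const x * fps_X) * fps_deriv (A x) = fps_const x * A x" for x
  proof (rule fps_ext)
    fix n
    show "fps_nth (2 * (1 - fps_const x * fps_X) * fps_deriv (A x)) n = fps_nth (fps_const x * A x) n"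
    proof (cases n)
      case 0
      show ?thesis using cbw'[of 0] by (simp add: 0 A_def algebra_simps fps_numeral_nth numeral_fps_const)
    next
      case (Suc m)
      have "fps_nth (2 * (1 - fps_const x * fps_X) * fps_deriv (A x)) n
        = 2 * (of_nat n + 1) * of_real (cbw (Suc n)) * x ^ Suc n - 2 * x * (of_nat n * of_real (cbw n) * x ^ n)"
        by (simp add: Suc A_def algebra_simps numeral_fps_const mult.assoc)
      also have "\<dots> = x * (of_real (cbw n) * x ^ n)"
        unfolding cbw' by (simp add: algebra_simps)
      finally show ?thesis by (simp add: A_def)
    qed
  qed
  have "2 * (1 - fps_const x * fps_X) * (1 - fps_const y * fps_X) * fps_deriv f
      = (1 - fps_const x * fps_X) * A x * (2 * (1 - fps_const y * fps_X) * fps_deriv (A y))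
      + (1 - fps_const y * fps_X) * A y * (2 * (1 - fps_const x * fps_X) * fps_deriv (A x))"
    by (simp add: f_def algebra_simps del: fps_const_add fps_const_mult)
  hence "2 * (1 - fps_const x * fps_X) * (1 - fps_const y * fps_X) * fps_deriv f
      = ((1 - fps_const x * fps_X) * fps_const y + (1 - fps_const y * fps_X) * fps_const x) * f"
    unfolding A_deriv by (simp add: f_def algebra_simps del: fps_const_add fps_const_mult)
  moreover have "2 * (1 - a * X) * (1 - b * X) * D = 2 * D - 2 * ((a + b) * (X * D)) + 2 * ((a * b) * (X * (X * D)))"
    and "((1 - a * X) * b + (1 - b * X) * a) * g = (a + b) * g - 2 * ((a * b) * (X * g))"
    for a b X D g :: "complex fps"
    by algebra+
  ultimately have "2 * fps_deriv f - 2 * ((fps_const x + fps_const y) * (fps_X * fps_deriv f))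
        + 2 * ((fps_const x * fps_const y) * (fps_X * (fps_X * fps_deriv f)))
      = (fps_const x + fps_const y) * f - 2 * ((fps_const x * fps_const y) * (fps_X * f))"
    by (simp only:)
  hence ode: "2 * fps_deriv f - 2 * (fps_const (2 + 4 * u) * (fps_X * fps_deriv f))
        + 2 * (fps_X * (fps_X * fps_deriv f)) = fps_const (2 + 4 * u) * f - 2 * (fps_X * f)"
    by (simp only: fps_const_add fps_const_mult assms fps_const_1_eq_1 mult_1_left)
  have rec: "of_nat (n + 2) * R (n + 2) =
     of_nat (2 * n + 3) * (1 + 2 * u) * R (n + 1) - of_nat (n + 1) * R n" for n
  proof -
    have "2 * (of_nat (n + 2) * R (n + 2)) - 2 * ((2 + 4 * u) * (of_nat (n + 1) * R (n + 1)))
       + 2 * (of_nat n * R n) = (2 + 4 * u) * R (n + 1) - 2 * R n"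
      using arg_cong[OF ode, of "\<lambda>g. fps_nth g (n + 1)"] unfolding R_nth
      by (cases n) (simp_all add: numeral_fps_const)
    hence "2 * (of_nat (n + 2) * R (n + 2)) =
      2 * (of_nat (2 * n + 3) * (1 + 2 * u) * R (n + 1) - of_nat (n + 1) * R n)"
      by (simp add: algebra_simps)
    thus ?thesis by (simp only: mult_cancel_left) simp
  qed
  have "shifted_legendre n u = R n \<and> shifted_legendre (n + 1) u = R (n + 1)"
  proof (induction n)
    case 0
    have c: "complex_of_real (cbw (Suc 0)) = 1/2" using cbw'[of 0] by (simp add: field_simps)
    have "x / 2 + y / 2 = 1 + 2 * u" using assms(2) by (simp add: field_simps)
    thus ?case
      by (simp add: shifted_legendre_def R_def c)
  next
    case (Suc n)
    have "of_nat (n + 2) * shifted_legendre (n + 2) u = of_nat (n + 2) * R (n + 2)"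
      using Suc unfolding rec legendre_rec by simp
    hence "shifted_legendre (n + 2) u = R (n + 2)"
      by (subst (asm) mult_cancel_left) (simp only: of_nat_eq_0_iff, simp)
    with Suc show ?case by simp
  qed
  thus ?thesis by (simp add: R_def)
qed

section \<open>Convolutions of the weights\<close>

lemma sum_cbw_convolution: "(\<Sum>k\<le>n. cbw k * cbw (n - k)) = 1"
proof -
  have "shifted_legendre n 0 = 1"
    by (simp add: shifted_legendre_def power_0_left if_distrib[of "\<lambda>x. _ * x"] cong: if_cong)
  moreover have "shifted_legendre n 0 = of_real (\<Sum>k\<le>n. cbw k * cbw (n - k))"
    by (subst legendre_eq_sum_cbw[of 1 1]) auto
  ultimately show ?thesis by (metis of_real_eq_1_iff)
qed

text \<open>
  The crude factor \<open>k + 1\<close> is uniform in \<open>n\<close>, which is what dominated convergence needs: it rests on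
  \<open>n \<le> (k + 1) * (n - k + 1)\<close>.
\<close>

lemma sqrt_cbw_le:
  assumes "k \<le> n"
  shows "sqrt (real n) * (cbw k * cbw (n - k)) \<le> real k + 1"
proof -
  have "real n \<le> (real k + 1) * (real (n - k) + 1)"
  proof -
    have "0 \<le> real k * (real n - real k)" using assms by simp
    thus ?thesis using assms by (simp add: of_nat_diff algebra_simps)
  qed
  hence *: "sqrt (real n) \<le> sqrt (real k + 1) * sqrt (real (n - k) + 1)"
    by (simp add: real_sqrt_mult[symmetric])
  have "sqrt (real n) * (cbw k * cbw (n - k)) \<le> sqrt (real n) * (1 * (1 / sqrt (real (n - k) + 1)))"
    using cbw_le_1[of k] cbw_pos[of k] cbw_pos[of "n - k"] cbw_upper[of "n - k"]
    by (intro mult_left_mono mult_mono) auto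
  also have "\<dots> \<le> sqrt (real k + 1)"
    using * by (simp add: divide_le_eq)
  also have "\<dots> \<le> real k + 1"
    by (rule real_le_lsqrt) (auto simp: power2_eq_square algebra_simps)
  finally show ?thesis .
qed

lemma summable_linear_times_power:
  assumes "0 \<le> r" "r < 1"
  shows "summable (\<lambda>k. (real k + 1) * r ^ k)"
proof -
  have "summable (\<lambda>k. of_nat (Suc k) * r ^ k)"
    using termdiff_converges[of r 1 "\<lambda>_. 1 :: real"] assms
    by (simp add: diffs_def summable_geometric)
  thus ?thesis by (simp add: add.commute)
qed

text \<open>
  For fixed \<open>k\<close> one has \<open>sqrt n * cbw (n - k) \<longlonglongrightarrow> 1 / sqrt pi\<close>, and the terms are dominated by
  \<open>(k + 1) * r ^ k\<close>; so Tannery's theorem lets the limit pass under the sum, leaving the binomial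
  series. The argument may vary with \<open>n\<close>, because it will be evaluated at points that move with \<open>n\<close>.
\<close>

lemma cbw_convolution_limit:
  fixes \<rho> :: "nat \<Rightarrow> complex"
  assumes lim: "\<rho> \<longlonglongrightarrow> \<sigma>" and "norm \<sigma> < 1"
  shows "(\<lambda>n. of_real (sqrt (real n)) * (\<Sum>k\<le>n. of_real (cbw k * cbw (n - k)) * \<rho> n ^ k))
           \<longlonglongrightarrow> (1 - \<sigma>) powr (-1/2) / of_real (sqrt pi)"
proof -
  define a where "a = (\<lambda>k n. if k \<le> n then of_real (sqrt (real n) * (cbw k * cbw (n - k))) * \<rho> n ^ k else 0)"
  define b where "b = (\<lambda>k. of_real (cbw k / sqrt pi) * \<sigma> ^ k)"
  obtain r where r: "norm \<sigma> < r" "r < 1" using dense assms(2) by blast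
  have r0: "0 \<le> r" using r(1) norm_ge_zero[of \<sigma>] by linarith
  have "(\<lambda>n. \<Sum>k. a k n) \<longlonglongrightarrow> (\<Sum>k. b k)"
  proof -
    have "(\<lambda>n. a k n) \<longlonglongrightarrow> b k" for k
    proof -
      have "(\<lambda>n. sqrt (real n) * cbw n * (sqrt (real n + real k) / sqrt (real n))) \<longlonglongrightarrow> 1 / sqrt pi * 1"
        by (intro tendsto_mult cbw_asymp) real_asymp
      hence "(\<lambda>n. sqrt (real n) * cbw n * (sqrt (real n + real k) / sqrt (real n))) \<longlonglongrightarrow> 1 / sqrt pi"
        by simp
      hence "(\<lambda>n. sqrt (real (n + k)) * cbw (n + k - k)) \<longlonglongrightarrow> 1 / sqrt pi"
        by (rule Lim_transform_eventually)
           (use eventually_gt_at_top[of "0::nat"] in \<open>eventually_elim, auto\<close>)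
      hence "(\<lambda>n. sqrt (real n) * cbw (n - k)) \<longlonglongrightarrow> 1 / sqrt pi"
        by (rule LIMSEQ_offset)
      hence "(\<lambda>n. of_real (cbw k * (sqrt (real n) * cbw (n - k))) * \<rho> n ^ k)
                 \<longlonglongrightarrow> of_real (cbw k * (1 / sqrt pi)) * \<sigma> ^ k"
        by (intro tendsto_intros lim)
      hence "(\<lambda>n. of_real (cbw k * (sqrt (real n) * cbw (n - k))) * \<rho> n ^ k) \<longlonglongrightarrow> b k"
        by (simp add: b_def)
      thus ?thesis
        by (rule Lim_transform_eventually)
           (auto intro!: eventually_mono[OF eventually_ge_at_top[of k]] simp: a_def mult_ac)
    qed
    moreover have "eventually (\<lambda>(k, n). norm (a k n) \<le> (real k + 1) * r ^ k) (at_top \<times>\<^sub>F sequentially)"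
    proof -
      have ev: "eventually (\<lambda>n. norm (\<rho> n) < r) sequentially"
        using tendsto_norm[OF lim] r(1) by (rule order_tendstoD)
      have "norm (a k n) \<le> (real k + 1) * r ^ k" if "norm (\<rho> n) < r" for k n
      proof (cases "k \<le> n")
        case True
        have "norm (a k n) = sqrt (real n) * (cbw k * cbw (n - k)) * norm (\<rho> n) ^ k"
          using True cbw_pos[of k] cbw_pos[of "n - k"]
          by (simp add: a_def norm_mult norm_power abs_mult)
        also have "\<dots> \<le> (real k + 1) * r ^ k"
          using sqrt_cbw_le[OF True] that by (intro mult_mono power_mono) auto
        finally show ?thesis .
      qed (use r0 in \<open>simp add: a_def\<close>)
      thus ?thesis unfolding eventually_prod_filter
        by (intro exI[of _ "\<lambda>_. True"] exI[of _ "\<lambda>n. norm (\<rho> n) < r"]) (use ev in auto)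
    qed
    ultimately show ?thesis
      using tannerys_theorem[of a b sequentially "\<lambda>k. (real k + 1) * r ^ k"]
        summable_linear_times_power[OF r0 r(2)] by simp
  qed
  moreover have "(\<Sum>k. a k n) = of_real (sqrt (real n)) * (\<Sum>k\<le>n. of_real (cbw k * cbw (n - k)) * \<rho> n ^ k)" for n
  proof -
    have "(\<Sum>k. a k n) = (\<Sum>k\<le>n. a k n)"
      by (intro suminf_finite) (auto simp: a_def)
    thus ?thesis by (simp add: a_def sum_distrib_left mult.assoc)
  qed
  moreover have "(\<Sum>k. b k) = (1 - \<sigma>) powr (-1/2) / of_real (sqrt pi)"
  proof -
    have "(\<lambda>k. of_real (cbw k) * \<sigma> ^ k / of_real (sqrt pi)) sums ((1 - \<sigma>) powr (-1/2) / of_real (sqrt pi))"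
      by (intro sums_divide cbw_sums assms)
    thus ?thesis by (simp add: b_def sums_iff)
  qed
  ultimately show ?thesis by simp
qed

section \<open>The exponential growth rate of Legendre polynomials\<close>

text \<open>
  The larger modulus of the two roots of \<open>x + 1/x = 2 + 4u\<close>. Expressing it through the sum of the
  distances to the foci \<open>0\<close> and \<open>-1\<close> avoids any choice of a branch, so that the resulting bounds hold
  on the whole plane, including the cut.
\<close>

definition growth :: "complex \<Rightarrow> real" where
  "growth u = exp (arcosh (norm u + norm (u + 1)))"

lemma focal_sum_ge_1: "norm u + norm (u + 1) \<ge> (1 :: real)" for u :: complex
  using norm_triangle_ineq4[of "u + 1" u] by (simp add: add.commute)

lemma growth_ge_1: "growth u \<ge> 1"
  unfolding growth_def one_le_exp_iff using focal_sum_ge_1[of u] by simp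

lemma growth_eqI:
  assumes "x \<ge> 1" "x + 1 / x = 2 * (norm u + norm (u + 1))"
  shows "growth u = x"
proof -
  have "cosh (ln x) = norm u + norm (u + 1)"
    using assms by (simp add: cosh_ln_real field_simps)
  hence "arcosh (norm u + norm (u + 1)) = ln x"
    using arcosh_cosh_real[of "ln x"] assms(1) by simp
  thus ?thesis using assms(1) by (simp add: growth_def)
qed

lemma focal_sum_le_growth: "norm u + norm (u + 1) \<le> growth u"
proof -
  define h where "h = arcosh (norm u + norm (u + 1))"
  have "h \<ge> 0" unfolding h_def using focal_sum_ge_1[of u] by simp
  have "norm u + norm (u + 1) = cosh h"
    by (simp add: h_def focal_sum_ge_1)
  also have "\<dots> \<le> exp h"
    using \<open>h \<ge> 0\<close> by (simp add: cosh_field_def)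
  finally show ?thesis by (simp add: growth_def h_def)
qed

text \<open>
  With \<open>v\<^sup>2 = x\<close> one has \<open>(v - 1/v)\<^sup>2 = 4u\<close> and \<open>(v + 1/v)\<^sup>2 = 4(u + 1)\<close>, so this is the
  parallelogram law: the level curves of the growth rate are ellipses with foci \<open>0\<close> and \<open>-1\<close>.
\<close>

lemma norm_add_reciprocal:
  fixes x y u :: complex
  assumes "x * y = 1" "x + y = 2 + 4 * u"
  shows "norm x + norm y = 2 * (norm u + norm (u + 1))"
proof -
  define v where "v = csqrt x"
  have v: "v\<^sup>2 = x" "v \<noteq> 0" using assms(1) by (auto simp: v_def)
  have y: "(1 / v)\<^sup>2 = y"
    using inverse_unique[OF assms(1)] v(1) by (simp add: power_divide inverse_eq_divide)
  have "(v - 1 / v)\<^sup>2 = v\<^sup>2 + (1 / v)\<^sup>2 - 2" "(v + 1 / v)\<^sup>2 = v\<^sup>2 + (1 / v)\<^sup>2 + 2"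
    using v(2) by (simp_all add: power2_eq_square algebra_simps)
  hence sq: "(v - 1 / v)\<^sup>2 = 4 * u" "(v + 1 / v)\<^sup>2 = 4 * (u + 1)"
    unfolding y v(1) using assms(2) by (simp_all add: algebra_simps)
  have par: "norm (a - b) ^ 2 + norm (a + b) ^ 2 = 2 * (norm a ^ 2 + norm b ^ 2)" for a b :: complex
    by (simp only: cmod_power2) (simp add: power2_eq_square algebra_simps)
  have "4 * norm u + 4 * norm (u + 1) = norm ((v - 1 / v)\<^sup>2) + norm ((v + 1 / v)\<^sup>2)"
    unfolding sq norm_mult by simp
  also have "\<dots> = 2 * (norm (v\<^sup>2) + norm ((1 / v)\<^sup>2))"
    unfolding norm_power by (rule par)
  finally show ?thesis unfolding v(1) y by simp
qed

lemma growth_eq_norm: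
  fixes x y u :: complex
  assumes "x * y = 1" "x + y = 2 + 4 * u" "norm x \<ge> 1"
  shows "growth u = norm x"
proof (rule growth_eqI)
  have "norm x * norm y = 1" using assms(1) by (metis norm_mult norm_one)
  hence "norm y = 1 / norm x" by (simp add: inverse_unique[symmetric] inverse_eq_divide[symmetric])
  thus "norm x + 1 / norm x = 2 * (norm u + norm (u + 1))"
    using norm_add_reciprocal[OF assms(1,2)] by simp
qed fact

text \<open>
  On a circle around \<open>0\<close> the logarithm of the growth rate lies below a linear function of the real
  part. Indeed it is \<open>arcosh (norm u + sqrt (norm u ^ 2 + 1 + 2 * Re u))\<close>, a composition of concave
  increasing functions of \<open>Re u\<close>, hence lies below its tangent at \<open>w\<close>. This is the inequality that
  confines the main contribution of the integral over the circle to a neighbourhood of \<open>w\<close>, even if \<open>w\<close>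
  is not real.
\<close>

lemma growth_le_exp_Re:
  assumes "norm u = norm w" "norm w + norm (w + 1) > 1" "w \<noteq> -1"
  defines "l \<equiv> 1 / (norm (w + 1) * sinh (arcosh (norm w + norm (w + 1))))"
  shows "growth u \<le> growth w * exp (l * (Re u - Re w))"
proof -
  define h where "h = arcosh (norm u + norm (u + 1))"
  define h0 where "h0 = arcosh (norm w + norm (w + 1))"
  have d0: "norm (w + 1) > 0" using assms(3) by (simp add: add_eq_0_iff2)
  have "h0 > 0" unfolding h0_def using assms(2) by (simp add: arcosh_real_gt_1_iff)
  hence sh: "sinh h0 > 0" by simp
  have ch: "cosh h = norm u + norm (u + 1)" "cosh h0 = norm w + norm (w + 1)"
    by (simp_all add: h_def h0_def focal_sum_ge_1)
  \<comment> \<open>The tangent of the hyperbolic cosine at \<open>h0\<close>, from those of the two exponentials.\<close>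
  have "exp h0 * (1 + (h - h0)) \<le> exp h0 * exp (h - h0)" "exp (-h0) * (1 + (h0 - h)) \<le> exp (-h0) * exp (h0 - h)"
    by (intro mult_left_mono exp_ge_add_one_self; simp)+
  hence "exp h0 * (1 + (h - h0)) \<le> exp h" "exp (-h0) * (1 + (h0 - h)) \<le> exp (-h)"
    by (simp_all add: exp_add[symmetric])
  hence "cosh h0 + sinh h0 * (h - h0) \<le> cosh h"
    by (simp add: cosh_field_def sinh_field_def field_simps)
  hence 1: "sinh h0 * (h - h0) \<le> norm (u + 1) - norm (w + 1)"
    unfolding ch assms(1) by simp
  \<comment> \<open>The tangent of the square root.\<close>
  have "(norm (u + 1))\<^sup>2 - (norm (w + 1))\<^sup>2 = 2 * (Re u - Re w)"
  proof -
    have "(norm (v + 1))\<^sup>2 = (norm v)\<^sup>2 + 2 * Re v + 1" for v :: complex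
      by (simp only: cmod_power2) (simp add: power2_eq_square algebra_simps)
    thus ?thesis using assms(1) by simp
  qed
  moreover have "2 * norm (w + 1) * (norm (u + 1) - norm (w + 1)) \<le> (norm (u + 1))\<^sup>2 - (norm (w + 1))\<^sup>2"
    using zero_le_power2[of "norm (u + 1) - norm (w + 1)"]
    by (simp add: power2_eq_square algebra_simps)
  ultimately have 2: "norm (w + 1) * (norm (u + 1) - norm (w + 1)) \<le> Re u - Re w" by simp
  have "norm (w + 1) * (sinh h0 * (h - h0)) \<le> norm (w + 1) * (norm (u + 1) - norm (w + 1))"
    using 1 by (rule mult_left_mono) simp
  with 2 have "(norm (w + 1) * sinh h0) * (h - h0) \<le> Re u - Re w" by (simp add: mult.assoc)
  hence "h - h0 \<le> l * (Re u - Re w)"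
    using d0 sh unfolding l_def h0_def[symmetric] by (simp add: field_simps)
  hence "exp h \<le> exp (h0 + l * (Re u - Re w))" by simp
  thus ?thesis by (simp add: growth_def h_def h0_def exp_add)
qed

lemma legendre_factor:
  assumes "x * y = 1" "x + y = 2 + 4 * u"
  shows "shifted_legendre n u = x ^ n * (\<Sum>k\<le>n. of_real (cbw k * cbw (n - k)) * (y\<^sup>2) ^ k)"
proof -
  have "x ^ (n - k) * y ^ k = x ^ n * (y\<^sup>2) ^ k" if "k \<le> n" for k
  proof -
    have "x ^ n = x ^ (n - k) * x ^ k" using that by (simp add: power_add[symmetric])
    hence "x ^ n * (y\<^sup>2) ^ k = x ^ (n - k) * (x * y) ^ k * y ^ k"
      by (simp add: power2_eq_square power_mult_distrib mult_ac)
    thus ?thesis using assms(1) by simp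
  qed
  thus ?thesis
    unfolding legendre_eq_sum_cbw[OF assms] sum_distrib_left
    by (intro sum.cong refl) (simp add: mult.assoc mult.left_commute)
qed

lemma exists_reciprocal_pair:
  obtains x y where "x * y = 1" "x + y = 2 + 4 * u" "norm x = growth u" "norm y = 1 / growth u"
proof -
  define x where "x = 1 + 2 * u + 2 * csqrt (u\<^sup>2 + u)"
  define y where "y = 1 + 2 * u - 2 * csqrt (u\<^sup>2 + u)"
  have "x * y = (1 + 2 * u)\<^sup>2 - 4 * (csqrt (u\<^sup>2 + u))\<^sup>2"
    unfolding x_def y_def power2_eq_square by (simp only: algebra_simps) simp
  also have "\<dots> = 1" unfolding power2_csqrt by (simp add: power2_eq_square algebra_simps)
  finally have xy: "x * y = 1" .
  have s: "x + y = 2 + 4 * u" by (simp add: x_def y_def)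
  have n: "norm x * norm y = 1" using xy by (metis norm_mult norm_one)
  show ?thesis
  proof (cases "norm x \<ge> 1")
    case True
    have "growth u = norm x" by (rule growth_eq_norm[OF xy s True])
    moreover from this have "norm y = 1 / growth u"
      using inverse_unique[OF n] by (simp add: inverse_eq_divide)
    ultimately show ?thesis using that xy s by simp
  next
    case False
    hence True: "norm y \<ge> 1" using n mult_le_one[of "norm x" "norm y"]
      by (smt (verit) mult_left_le norm_ge_zero mult_less_cancel_left1)
    have "growth u = norm y" by (rule growth_eq_norm[OF _ _ True, of x]) (use xy s in \<open>simp_all add: add.commute mult.commute\<close>)
    moreover from this have "norm x = 1 / growth u"
      using inverse_unique[of "norm y" "norm x"] n by (simp add: inverse_eq_divide mult.commute)
    ultimately show ?thesis using that[of y x] xy s by (simp add: add.commute mult.commute)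
  qed
qed

text \<open>
  The weights in the convolution add up to \<open>1\<close>, which gives the bound valid everywhere. Away from the
  segment between the foci the growth rate exceeds \<open>1\<close>, the weights with large \<open>k\<close> are damped
  geometrically, and a factor \<open>sqrt n\<close> is gained.
\<close>

lemma norm_legendre_le_growth: "norm (shifted_legendre n u) \<le> growth u ^ n"
  and norm_sqrt_legendre_le: "r < 1 \<Longrightarrow> 1 / (growth u)\<^sup>2 \<le> r \<Longrightarrow>
     sqrt (real n) * norm (shifted_legendre n u) \<le> (\<Sum>k. (real k + 1) * r ^ k) * growth u ^ n"
proof -
  obtain x y where xy: "x * y = 1" "x + y = 2 + 4 * u" "norm x = growth u" "norm y = 1 / growth u"
    by (rule exists_reciprocal_pair)
  have g: "growth u \<ge> 1" by (rule growth_ge_1)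
  have *: "norm (shifted_legendre n u) \<le> growth u ^ n * (\<Sum>k\<le>n. cbw k * cbw (n - k) * (1 / (growth u)\<^sup>2) ^ k)"
  proof -
    have "norm (\<Sum>k\<le>n. of_real (cbw k * cbw (n - k)) * (y\<^sup>2) ^ k)
      \<le> (\<Sum>k\<le>n. norm (of_real (cbw k * cbw (n - k)) * (y\<^sup>2) ^ k))" by (rule norm_sum)
    also have "\<dots> = (\<Sum>k\<le>n. cbw k * cbw (n - k) * (1 / (growth u)\<^sup>2) ^ k)"
      using cbw_pos[THEN less_imp_le] by (simp add: norm_mult norm_power xy(4) power_divide abs_mult)
    finally show ?thesis
      unfolding legendre_factor[OF xy(1,2)] norm_mult norm_power xy(3)
      using g by (intro mult_left_mono) auto
  qed
  show "norm (shifted_legendre n u) \<le> growth u ^ n"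
  proof -
    have "(\<Sum>k\<le>n. cbw k * cbw (n - k) * (1 / (growth u)\<^sup>2) ^ k) \<le> (\<Sum>k\<le>n. cbw k * cbw (n - k) * 1)"
      using g cbw_pos[THEN less_imp_le]
      by (intro sum_mono mult_left_mono power_le_one) (auto simp: divide_le_eq)
    also have "\<dots> = 1" by (simp add: sum_cbw_convolution)
    finally have "growth u ^ n * (\<Sum>k\<le>n. cbw k * cbw (n - k) * (1 / (growth u)\<^sup>2) ^ k) \<le> growth u ^ n * 1"
      using g by (intro mult_left_mono) auto
    with * show ?thesis by simp
  qed
  assume r: "r < 1" "1 / (growth u)\<^sup>2 \<le> r"
  have r0: "0 \<le> r" using r(2) by (rule order_trans[rotated]) simp
  have "sqrt (real n) * norm (shifted_legendre n u) \<le>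
     sqrt (real n) * (growth u ^ n * (\<Sum>k\<le>n. cbw k * cbw (n - k) * (1 / (growth u)\<^sup>2) ^ k))"
    using * by (rule mult_left_mono) simp
  also have "\<dots> = (\<Sum>k\<le>n. sqrt (real n) * (cbw k * cbw (n - k)) * (1 / (growth u)\<^sup>2) ^ k) * growth u ^ n"
    by (simp add: sum_distrib_left sum_distrib_right mult_ac)
  also have "\<dots> \<le> (\<Sum>k. (real k + 1) * r ^ k) * growth u ^ n"
  proof (rule mult_right_mono)
    have "(\<Sum>k\<le>n. sqrt (real n) * (cbw k * cbw (n - k)) * (1 / (growth u)\<^sup>2) ^ k) \<le> (\<Sum>k\<le>n. (real k + 1) * r ^ k)"
      using r r0 by (intro sum_mono mult_mono power_mono sqrt_cbw_le) auto
    also have "\<dots> \<le> (\<Sum>k. (real k + 1) * r ^ k)"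
      using r r0 by (intro sum_le_suminf summable_linear_times_power) auto
    finally show "(\<Sum>k\<le>n. sqrt (real n) * (cbw k * cbw (n - k)) * (1 / (growth u)\<^sup>2) ^ k) \<le> (\<Sum>k. (real k + 1) * r ^ k)" .
  qed (use g in auto)
  finally show "sqrt (real n) * norm (shifted_legendre n u) \<le> (\<Sum>k. (real k + 1) * r ^ k) * growth u ^ n" .
qed

section \<open>Local asymptotics in the right half-plane\<close>

lemma Re_csqrt_pos:
  assumes "z \<notin> \<real>\<^sub>\<le>\<^sub>0"
  shows "Re (csqrt z) > 0"
proof (rule ccontr)
  assume "\<not> ?thesis"
  hence "Re (csqrt z) = 0" using csqrt_principal[of z] by linarith
  hence "(csqrt z)\<^sup>2 = of_real (- (Im (csqrt z))\<^sup>2)"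
    by (simp add: complex_eq_iff power2_eq_square)
  hence "z = of_real (- (Im (csqrt z))\<^sup>2)" unfolding power2_csqrt .
  hence "z \<in> \<real>\<^sub>\<le>\<^sub>0"
    by (metis complex_nonpos_Reals_iff Im_complex_of_real Re_complex_of_real neg_le_0_iff_le zero_le_power2)
  with assms show False by simp
qed

definition crit_root :: "complex \<Rightarrow> complex" where
  "crit_root u = csqrt (u\<^sup>2 + u)"

text \<open>
  The inverse of the Joukowski-type map \<open>x \<mapsto> (x + 1/x - 2) / 4\<close> on the right half-plane, in the branch
  with values outside the unit disc.
\<close>

definition joukowski :: "complex \<Rightarrow> complex" where
  "joukowski u = 1 + 2 * u + 2 * crit_root u"

lemma quadratic_not_nonpos:
  assumes "Re u > 0"
  shows "u\<^sup>2 + u \<notin> \<real>\<^sub>\<le>\<^sub>0"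
proof
  assume *: "u\<^sup>2 + u \<in> \<real>\<^sub>\<le>\<^sub>0"
  have "Im (u\<^sup>2 + u) = Im u * (2 * Re u + 1)" by (simp add: power2_eq_square algebra_simps)
  with * assms have "Im u = 0" by (auto simp: complex_nonpos_Reals_iff)
  hence "Re (u\<^sup>2 + u) > 0" using assms by (simp add: power2_eq_square add_pos_pos)
  with * show False by (auto simp: complex_nonpos_Reals_iff)
qed

lemma crit_root_sq: "(crit_root u)\<^sup>2 = u\<^sup>2 + u"
  by (simp add: crit_root_def)

lemma Re_crit_root_pos: "Re u > 0 \<Longrightarrow> Re (crit_root u) > 0"
  unfolding crit_root_def by (rule Re_csqrt_pos[OF quadratic_not_nonpos])

lemma crit_root_nonzero: "Re u > 0 \<Longrightarrow> crit_root u \<noteq> 0"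
  using Re_crit_root_pos[of u] by auto

lemma joukowski_reciprocal: "joukowski u * (1 + 2 * u - 2 * crit_root u) = 1"
proof -
  have "joukowski u * (1 + 2 * u - 2 * crit_root u) = (1 + 2 * u)\<^sup>2 - 4 * (crit_root u)\<^sup>2"
    unfolding joukowski_def power2_eq_square by (simp only: algebra_simps) simp
  thus ?thesis unfolding crit_root_sq by (simp add: power2_eq_square algebra_simps)
qed

lemma joukowski_nonzero: "joukowski u \<noteq> 0"
  using joukowski_reciprocal[of u] by auto

lemma inverse_joukowski: "1 / joukowski u = 1 + 2 * u - 2 * crit_root u"
  using inverse_unique[OF joukowski_reciprocal[of u]] by (simp add: inverse_eq_divide)

text \<open>
  The two roots \<open>1 + 2u \<plusminus> 2r\<close> of the quadratic are reciprocal to each other, so it suffices that the one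
  with the plus sign is larger. Now \<open>Im r\<close> and \<open>Im u\<close> have the same sign, because
  \<open>2 * Re r * Im r = Im (u\<^sup>2 + u) = Im u * (2 * Re u + 1)\<close>; hence \<open>1 + 2u\<close> and \<open>r\<close> enclose an acute
  angle.
\<close>

lemma norm_joukowski_gt_1:
  assumes "Re u > 0"
  shows "norm (joukowski u) > 1"
proof -
  define r where "r = crit_root u"
  have r: "Re r > 0" using Re_crit_root_pos[OF assms] by (simp add: r_def)
  have "Im (r\<^sup>2) = Im (u\<^sup>2 + u)" unfolding r_def crit_root_sq ..
  hence "2 * Re r * Im r = Im u * (2 * Re u + 1)" by (simp add: power2_eq_square algebra_simps)
  hence "(2 * Re r) * (Im r * Im u) = (Im u)\<^sup>2 * (2 * Re u + 1)"
    by (simp add: power2_eq_square mult_ac)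
  hence "(2 * Re r) * (Im r * Im u) \<ge> 0" using assms by simp
  hence im: "Im r * Im u \<ge> 0" using r by (simp add: zero_le_mult_iff)
  have "Re r * (1 + 2 * Re u) > 0" using r assms by (intro mult_pos_pos) auto
  with im have pos: "(1 + 2 * Re u) * Re r + 2 * (Im u * Im r) > 0" by (simp add: mult.commute)
  have "(norm (1 + 2 * u + 2 * r))\<^sup>2 - (norm (1 + 2 * u - 2 * r))\<^sup>2 =
     8 * ((1 + 2 * Re u) * Re r + 2 * (Im u * Im r))"
    by (simp only: cmod_power2) (simp add: power2_eq_square algebra_simps)
  with pos have "(norm (1 + 2 * u - 2 * r))\<^sup>2 < (norm (1 + 2 * u + 2 * r))\<^sup>2" by simp
  hence less: "norm (1 / joukowski u) < norm (joukowski u)"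
    unfolding inverse_joukowski unfolding joukowski_def r_def by (rule power_less_imp_less_base) simp
  show ?thesis
  proof (rule ccontr)
    assume "\<not> ?thesis"
    hence "norm (joukowski u) \<le> 1" by simp
    moreover from this have "1 / norm (joukowski u) \<ge> 1"
      using joukowski_nonzero[of u] by (simp add: le_divide_eq)
    ultimately show False using less by (simp add: norm_divide)
  qed
qed

lemma growth_eq_norm_joukowski:
  assumes "Re u > 0"
  shows "growth u = norm (joukowski u)"
  using norm_joukowski_gt_1[OF assms] joukowski_reciprocal[of u]
  by (intro growth_eq_norm[where y = "1 + 2 * u - 2 * crit_root u"]) (auto simp: joukowski_def)

lemma Re_joukowski_pos: "Re u > 0 \<Longrightarrow> Re (joukowski u) > 0"
  using Re_crit_root_pos[of u] by (simp add: joukowski_def)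

lemma crit_root_deriv:
  assumes "Re u > 0"
  shows "(crit_root has_field_derivative (2 * u + 1) / (2 * crit_root u)) (at u)"
  unfolding crit_root_def [abs_def]
  by (rule derivative_eq_intros refl quadratic_not_nonpos assms)+
     (simp add: crit_root_def field_simps)

text \<open>
  With \<open>joukowski u = exp \<eta>\<close> one has \<open>cosh \<eta> = 1 + 2u\<close> and \<open>sinh \<eta> = 2 * crit_root u\<close>, whence the
  simple derivative.
\<close>

lemma Ln_joukowski_deriv:
  assumes "Re u > 0"
  shows "((\<lambda>u. Ln (joukowski u)) has_field_derivative 1 / crit_root u) (at u)"
proof -
  have "joukowski u \<notin> \<real>\<^sub>\<le>\<^sub>0"
    using Re_joukowski_pos[OF assms] by (auto simp: complex_nonpos_Reals_iff)
  moreover have "(joukowski has_field_derivative 2 + 2 * ((2 * u + 1) / (2 * crit_root u))) (at u)"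
    unfolding joukowski_def [abs_def]
    by (rule derivative_eq_intros crit_root_deriv assms refl)+ simp
  ultimately have "((\<lambda>u. Ln (joukowski u)) has_field_derivative
      (2 + 2 * ((2 * u + 1) / (2 * crit_root u))) / joukowski u) (at u)"
    by (auto intro!: derivative_eq_intros simp: field_simps)
  moreover have "2 + 2 * ((2 * u + 1) / (2 * crit_root u)) = joukowski u / crit_root u"
    using crit_root_nonzero[OF assms] by (simp add: joukowski_def field_simps)
  ultimately show ?thesis using joukowski_nonzero[of u] by simp
qed

text \<open>
  Second-order Taylor expansion with Peano remainder: the remainder has derivative \<open>o(norm x)\<close>, so it is
  \<open>o(norm x ^ 2)\<close> by the mean value inequality, and the odd terms cancel.
\<close>

lemma second_symmetric_difference_limit:
  fixes f f' :: "complex \<Rightarrow> complex"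
  assumes d: "d > 0" and f: "\<And>x. norm x < d \<Longrightarrow> (f has_field_derivative f' x) (at x)"
    and f': "(f' has_field_derivative c) (at 0)"
  shows "((\<lambda>x. (f x + f (-x) - 2 * f 0) / x\<^sup>2) \<longlongrightarrow> c) (at 0)"
proof (rule tendstoI)
  fix e :: real assume e: "e > 0"
  have "((\<lambda>h. (f' h - f' 0) / h) \<longlongrightarrow> c) (at 0)"
    using f' by (simp add: has_field_derivative_iff)
  hence "eventually (\<lambda>h. dist ((f' h - f' 0) / h) c < e / 4) (at 0)"
    by (rule tendstoD) (use e in simp)
  then obtain \<delta> where \<delta>: "\<delta> > 0" "\<And>h. h \<noteq> 0 \<Longrightarrow> norm h < \<delta> \<Longrightarrow> dist ((f' h - f' 0) / h) c < e / 4"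
    by (auto simp: eventually_at)
  define R where "R = (\<lambda>x. f x - f 0 - f' 0 * x - c * x\<^sup>2 / 2)"
  have R: "norm (R x) \<le> e / 4 * (norm x)\<^sup>2" if x: "norm x < min d \<delta>" for x
  proof -
    have "norm (R x - R 0) \<le> (e / 4 * norm x) * norm (x - 0)"
    proof (rule field_differentiable_bound[of "cball 0 (norm x)" R "\<lambda>y. f' y - f' 0 - c * y"])
      fix y :: complex assume "y \<in> cball 0 (norm x)"
      hence y: "norm y \<le> norm x" by simp
      show "(R has_field_derivative f' y - f' 0 - c * y) (at y within cball 0 (norm x))"
      proof (rule has_field_derivative_at_within)
        have "(f has_field_derivative f' y) (at y)" using y x by (intro f) auto
        thus "(R has_field_derivative f' y - f' 0 - c * y) (at y)"
          unfolding R_def by (auto intro!: derivative_eq_intros)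
      qed
      show "norm (f' y - f' 0 - c * y) \<le> e / 4 * norm x"
      proof (cases "y = 0")
        case False
        have "norm (f' y - f' 0 - c * y) = norm ((f' y - f' 0) / y - c) * norm y"
        proof -
          have "f' y - f' 0 - c * y = ((f' y - f' 0) / y - c) * y"
            unfolding left_diff_distrib using False by simp
          thus ?thesis by (simp only: norm_mult)
        qed
        also have "\<dots> \<le> e / 4 * norm x"
          using \<delta>(2)[of y] False x y e by (intro mult_mono) (auto simp: dist_norm)
        finally show ?thesis .
      qed (use e in simp)
    qed auto
    thus ?thesis by (simp add: R_def power2_eq_square)
  qed
  show "eventually (\<lambda>x. dist ((f x + f (-x) - 2 * f 0) / x\<^sup>2) c < e) (at 0)"
    unfolding eventually_at
  proof (intro exI[of _ "min d \<delta>"] conjI ballI impI)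
    fix x :: complex assume "x \<noteq> 0 \<and> dist x 0 < min d \<delta>"
    hence x: "x \<noteq> 0" "norm x < min d \<delta>" by auto
    have "(f x + f (-x) - 2 * f 0) / x\<^sup>2 - c = (R x + R (-x)) / x\<^sup>2"
      using x(1) by (simp add: R_def field_simps)
    hence "dist ((f x + f (-x) - 2 * f 0) / x\<^sup>2) c = norm (R x + R (-x)) / (norm x)\<^sup>2"
      by (simp add: dist_norm norm_divide norm_power)
    also have "\<dots> \<le> (e / 4 * (norm x)\<^sup>2 + e / 4 * (norm x)\<^sup>2) / (norm x)\<^sup>2"
      using R[of x] R[of "-x"] x by (intro divide_right_mono order_trans[OF norm_triangle_ineq]) auto
    also have "\<dots> < e" using x(1) e by (simp add: add_divide_distrib)
    finally show "dist ((f x + f (-x) - 2 * f 0) / x\<^sup>2) c < e" .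
  qed (use d \<delta> in auto)
qed

lemma legendre_asymptotic:
  assumes lim: "u \<longlonglongrightarrow> w" and w: "Re w > 0"
  shows "(\<lambda>n. of_real (sqrt (real n)) * shifted_legendre n (u n) / joukowski (u n) ^ n)
           \<longlonglongrightarrow> (1 - 1 / (joukowski w)\<^sup>2) powr (-1/2) / of_real (sqrt pi)"
proof -
  define \<rho> where "\<rho> = (\<lambda>n. (1 / joukowski (u n))\<^sup>2)"
  have cont: "isCont crit_root w" by (rule DERIV_isCont[OF crit_root_deriv[OF w]])
  have "(\<lambda>n. crit_root (u n)) \<longlonglongrightarrow> crit_root w"
    by (rule isCont_tendsto_compose[OF cont lim])
  hence "(\<lambda>n. joukowski (u n)) \<longlonglongrightarrow> joukowski w"
    unfolding joukowski_def by (intro tendsto_intros lim)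
  hence \<rho>: "\<rho> \<longlonglongrightarrow> (1 / joukowski w)\<^sup>2"
    unfolding \<rho>_def by (intro tendsto_intros joukowski_nonzero)
  have "norm ((1 / joukowski w)\<^sup>2) < 1"
    using norm_joukowski_gt_1[OF w] by (simp add: norm_power norm_divide power_less_one_iff divide_less_eq)
  from cbw_convolution_limit[OF \<rho> this]
  have "(\<lambda>n. of_real (sqrt (real n)) * (\<Sum>k\<le>n. of_real (cbw k * cbw (n - k)) * \<rho> n ^ k))
           \<longlonglongrightarrow> (1 - 1 / (joukowski w)\<^sup>2) powr (-1/2) / of_real (sqrt pi)"
    by (simp add: power_divide)
  moreover have "shifted_legendre n (u n) / joukowski (u n) ^ n = (\<Sum>k\<le>n. of_real (cbw k * cbw (n - k)) * \<rho> n ^ k)" for n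
  proof -
    have "shifted_legendre n (u n) = joukowski (u n) ^ n * (\<Sum>k\<le>n. of_real (cbw k * cbw (n - k)) * \<rho> n ^ k)"
      unfolding \<rho>_def
    proof (rule legendre_factor)
      show "joukowski (u n) + 1 / joukowski (u n) = 2 + 4 * u n"
        unfolding inverse_joukowski by (simp add: joukowski_def)
    qed (simp add: joukowski_nonzero)
    thus ?thesis using joukowski_nonzero[of "u n"] by simp
  qed
  ultimately show ?thesis by (simp only: times_divide_eq_right[symmetric])
qed

text \<open>
  The logarithm of the quantity in parentheses is a symmetric second difference of
  \<open>f x = Ln (joukowski (w * exp (\<i>x)))\<close> with step \<open>t / sqrt n\<close>. Multiplied by \<open>n\<close> it tends to
  \<open>t\<^sup>2 * f'' 0\<close>, and \<open>f'' 0 = - w\<^sup>2 / (2 * crit_root w ^ 3)\<close> since \<open>f' = \<i> * u / crit_root u\<close> along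
  \<open>u = w * exp (\<i>x)\<close>.
\<close>

lemma phase_limit:
  assumes w: "Re w > 0"
  shows "(\<lambda>n. (joukowski (w * exp (\<i> * of_real (t / sqrt (real n)))) *
               joukowski (w * exp (- (\<i> * of_real (t / sqrt (real n))))) / (joukowski w)\<^sup>2) ^ n)
           \<longlonglongrightarrow> exp (- (w\<^sup>2 / (2 * crit_root w ^ 3)) * of_real (t\<^sup>2))"
proof (cases "t = 0")
  case True
  thus ?thesis using joukowski_nonzero[of w] by (simp add: power2_eq_square)
next
  case False
  define u where "u = (\<lambda>x. w * exp (\<i> * x))"
  define f where "f = (\<lambda>x. Ln (joukowski (u x)))"
  define f' where "f' = (\<lambda>x. \<i> * u x / crit_root (u x))"
  define c where "c = - (w\<^sup>2 / (2 * crit_root w ^ 3))"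
  have u0: "u 0 = w" by (simp add: u_def)
  have u_deriv: "(u has_field_derivative \<i> * u x) (at x)" for x
    unfolding u_def by (auto intro!: derivative_eq_intros)
  obtain d where d: "d > 0" "\<And>x. norm x < d \<Longrightarrow> Re (u x) > 0"
  proof -
    have "isCont (\<lambda>x. Re (u x)) 0" using DERIV_isCont[OF u_deriv] by (intro isCont_Re) blast
    hence "eventually (\<lambda>x. Re (u x) > 0) (nhds 0)"
      using w by (intro order_tendstoD) (auto simp: isCont_def tendsto_nhds_iff u0)
    thus ?thesis using that by (auto simp: eventually_nhds_metric)
  qed
  have f_deriv: "(f has_field_derivative f' x) (at x)" if "norm x < d" for x
    using DERIV_chain2[OF Ln_joukowski_deriv[OF d(2)[OF that]] u_deriv]
    by (simp add: f_def f'_def)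
  have "(f' has_field_derivative c) (at 0)"
  proof -
    have "((\<lambda>x. crit_root (u x)) has_field_derivative (2 * u 0 + 1) / (2 * crit_root (u 0)) * (\<i> * u 0)) (at 0)"
      by (rule DERIV_chain2[OF crit_root_deriv u_deriv]) (use w in \<open>simp add: u0\<close>)
    moreover have "((\<lambda>x. \<i> * u x) has_field_derivative \<i> * (\<i> * w)) (at 0)"
      using u_deriv[of 0] unfolding u0 by (rule DERIV_cmult)
    ultimately have "((\<lambda>x. \<i> * u x / crit_root (u x)) has_field_derivative
       (\<i> * (\<i> * w) * crit_root (u 0) - \<i> * u 0 * ((2 * u 0 + 1) / (2 * crit_root (u 0)) * (\<i> * u 0)))
         / (crit_root (u 0) * crit_root (u 0))) (at 0)"
      by (intro DERIV_divide) (use crit_root_nonzero[OF w] in \<open>simp_all add: u0\<close>)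
    hence "(f' has_field_derivative
       (\<i> * (\<i> * w) * crit_root w - \<i> * w * ((2 * w + 1) / (2 * crit_root w) * (\<i> * w)))
         / (crit_root w * crit_root w)) (at 0)"
      unfolding f'_def u0 .
    also have "(\<i> * (\<i> * w) * crit_root w - \<i> * w * ((2 * w + 1) / (2 * crit_root w) * (\<i> * w)))
         / (crit_root w * crit_root w) = c"
    proof -
      have nz: "crit_root w \<noteq> 0" by (rule crit_root_nonzero[OF w])
      have "(\<i> * (\<i> * w) * crit_root w - \<i> * w * ((2 * w + 1) / (2 * crit_root w) * (\<i> * w)))
         / (crit_root w * crit_root w) = - (w * (2 * (crit_root w)\<^sup>2 - w * (2 * w + 1)) / (2 * crit_root w ^ 3))"
        using nz by (simp add: field_simps power2_eq_square power3_eq_cube)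
      also have "w * (2 * (crit_root w)\<^sup>2 - w * (2 * w + 1)) = w\<^sup>2"
        unfolding crit_root_sq by (simp add: power2_eq_square algebra_simps)
      finally show ?thesis by (simp add: c_def)
    qed
    finally show ?thesis .
  qed
  from second_symmetric_difference_limit[OF d(1) f_deriv this]
  have L: "((\<lambda>x. (f x + f (-x) - 2 * f 0) / x\<^sup>2) \<longlongrightarrow> c) (at 0)" .
  define \<tau> where "\<tau> = (\<lambda>n. complex_of_real (t / sqrt (real n)))"
  have "(\<lambda>n. t / sqrt (real n)) \<longlonglongrightarrow> 0" by real_asymp
  hence \<tau>0: "\<tau> \<longlonglongrightarrow> 0" unfolding \<tau>_def using tendsto_of_real[of "\<lambda>n. t / sqrt (real n)" 0 sequentially, where 'a = complex] by simp
  have "filterlim \<tau> (at 0) sequentially"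
    unfolding filterlim_at using \<tau>0 False eventually_gt_at_top[of "0::nat"]
    by (auto simp: \<tau>_def elim!: eventually_mono)
  hence "(\<lambda>n. (f (\<tau> n) + f (- \<tau> n) - 2 * f 0) / (\<tau> n)\<^sup>2) \<longlonglongrightarrow> c"
    by (rule filterlim_compose[OF L])
  hence "(\<lambda>n. (f (\<tau> n) + f (- \<tau> n) - 2 * f 0) / (\<tau> n)\<^sup>2 * of_real (t\<^sup>2)) \<longlonglongrightarrow> c * of_real (t\<^sup>2)"
    by (intro tendsto_intros)
  hence "(\<lambda>n. of_nat n * (f (\<tau> n) + f (- \<tau> n) - 2 * f 0)) \<longlonglongrightarrow> c * of_real (t\<^sup>2)"
  proof (rule Lim_transform_eventually)
    show "eventually (\<lambda>n. (f (\<tau> n) + f (- \<tau> n) - 2 * f 0) / (\<tau> n)\<^sup>2 * of_real (t\<^sup>2)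
             = of_nat n * (f (\<tau> n) + f (- \<tau> n) - 2 * f 0)) sequentially"
      using eventually_gt_at_top[of "0::nat"]
    proof eventually_elim
      case (elim n)
      have "(\<tau> n)\<^sup>2 = of_real (t\<^sup>2 / real n)"
        unfolding \<tau>_def of_real_power[symmetric] by (simp add: power_divide)
      hence "of_real (t\<^sup>2) = of_nat n * (\<tau> n)\<^sup>2" using elim by simp
      moreover have "\<tau> n \<noteq> 0" using elim False by (simp add: \<tau>_def)
      ultimately show ?case by simp
    qed
  qed
  hence "(\<lambda>n. exp (of_nat n * (f (\<tau> n) + f (- \<tau> n) - 2 * f 0))) \<longlonglongrightarrow> exp (c * of_real (t\<^sup>2))"
    by (rule tendsto_exp)
  moreover have "exp (of_nat n * (f (\<tau> n) + f (- \<tau> n) - 2 * f 0)) =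
      (joukowski (u (\<tau> n)) * joukowski (u (- \<tau> n)) / (joukowski w)\<^sup>2) ^ n" for n
  proof -
    have "exp (f x) = joukowski (u x)" for x
      by (simp add: f_def joukowski_nonzero)
    hence "exp (f (\<tau> n) + f (- \<tau> n) - 2 * f 0) = joukowski (u (\<tau> n)) * joukowski (u (- \<tau> n)) / (joukowski w)\<^sup>2"
      by (simp add: exp_diff exp_add exp_double u0)
    thus ?thesis by (simp add: exp_of_nat_mult)
  qed
  ultimately show ?thesis by (simp add: u_def \<tau>_def c_def)
qed

section \<open>Gaussian integrals with complex exponent\<close>

lemma gaussian_even_moment:
  "has_bochner_integral lborel (\<lambda>x::real. exp (-x\<^sup>2) * x ^ (2 * k)) (sqrt pi * (cbw k * fact k))"
proof -
  have "has_bochner_integral lborel (\<lambda>x::real. exp (-x\<^sup>2) * x ^ (2 * k))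
     (2 *\<^sub>R ((sqrt pi / 2) * (fact (2 * k) / (2 ^ (2 * k) * fact k))))"
    by (rule has_bochner_integral_even_function[OF gaussian_moment_even_pos]) simp
  also have "2 *\<^sub>R ((sqrt pi / 2) * (fact (2 * k) / (2 ^ (2 * k) * fact k))) = sqrt pi * (cbw k * fact k)"
    by (simp add: cbw_def fact_double)
  finally show ?thesis .
qed

text \<open>
  Expand \<open>exp (-b * x\<^sup>2) = exp (-x\<^sup>2) * exp (h * x\<^sup>2)\<close> in powers of \<open>h = 1 - b\<close> and integrate termwise:
  the even moments of the Gaussian turn the series into the binomial series of \<open>(1 - h) powr (-1/2)\<close>.
\<close>

lemma gaussian_integral_disc:
  fixes b :: complex
  assumes "norm (1 - b) < 1"
  shows "has_bochner_integral lborel (\<lambda>x. exp (- b * of_real (x\<^sup>2))) (of_real (sqrt pi) * b powr (-1/2))"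
proof -
  define h where "h = 1 - b"
  define f where "f = (\<lambda>k (x::real). (h ^ k / fact k) * of_real (exp (-x\<^sup>2) * x ^ (2 * k)))"
  have f_alt: "f k x = (h * of_real (x\<^sup>2)) ^ k /\<^sub>R fact k * of_real (exp (-x\<^sup>2))" for k x
  proof -
    have "complex_of_real (x ^ (2 * k)) = of_real (x\<^sup>2) ^ k" by (simp only: power_mult of_real_power)
    thus ?thesis unfolding f_def of_real_mult power_mult_distrib scaleR_conv_of_real
      by (simp add: divide_inverse mult_ac)
  qed
  have f_int: "has_bochner_integral lborel (f k) ((h ^ k / fact k) * of_real (sqrt pi * (cbw k * fact k)))" for k
    unfolding f_def
    by (intro has_bochner_integral_mult_right has_bochner_integral_of_real gaussian_even_moment)
  have norm_int: "has_bochner_integral lborel (\<lambda>x. norm (f k x)) ((norm h ^ k / fact k) * (sqrt pi * (cbw k * fact k)))" for k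
  proof -
    have *: "(\<lambda>x. norm (f k x)) = (\<lambda>x. (norm h ^ k / fact k) * (exp (-x\<^sup>2) * x ^ (2 * k)))"
      by (simp add: f_def norm_mult norm_divide norm_power fun_eq_iff power_mult)
    show ?thesis unfolding * by (intro has_bochner_integral_mult_right gaussian_even_moment)
  qed
  have sums: "(\<lambda>k. f k x) sums exp (- b * of_real (x\<^sup>2))" for x
  proof -
    have "(\<lambda>k. (h * of_real (x\<^sup>2)) ^ k /\<^sub>R fact k) sums exp (h * of_real (x\<^sup>2))"
      by (rule exp_converges)
    hence "(\<lambda>k. (h * of_real (x\<^sup>2)) ^ k /\<^sub>R fact k * of_real (exp (-x\<^sup>2))) sums
       (exp (h * of_real (x\<^sup>2)) * of_real (exp (-x\<^sup>2)))"
      by (rule sums_mult2)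
    also have "exp (h * of_real (x\<^sup>2)) * of_real (exp (-x\<^sup>2)) = exp (- b * of_real (x\<^sup>2))"
      by (simp add: exp_of_real[symmetric] exp_add[symmetric] h_def algebra_simps)
    finally show ?thesis unfolding f_alt .
  qed
  have abs_sum: "summable (\<lambda>k. norm (f k x))" for x
  proof -
    have "summable (\<lambda>k. (norm h * x\<^sup>2) ^ k /\<^sub>R fact k)" using exp_converges sums_summable by blast
    hence "summable (\<lambda>k. (norm h * x\<^sup>2) ^ k /\<^sub>R fact k * exp (-x\<^sup>2))" by (rule summable_mult2)
    moreover have "norm (f k x) = (norm h * x\<^sup>2) ^ k /\<^sub>R fact k * exp (-x\<^sup>2)" for k
      unfolding f_alt norm_mult norm_scaleR norm_power norm_of_real by simp
    ultimately show ?thesis by simp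
  qed
  have norm_sum: "summable (\<lambda>k. integral\<^sup>L lborel (\<lambda>x. norm (f k x)))"
  proof -
    have "summable (\<lambda>k. norm (of_real (cbw k) * complex_of_real (norm h) ^ k))"
    proof (rule summable_comparison_test')
      show "summable (\<lambda>k. norm h ^ k)" using assms by (simp add: h_def summable_geometric)
      show "norm (norm (of_real (cbw k) * complex_of_real (norm h) ^ k)) \<le> norm h ^ k" if "k \<ge> 0" for k
        using cbw_le_1[of k] cbw_pos[of k] by (simp add: norm_mult norm_power mult_left_le_one_le)
    qed
    hence "summable (\<lambda>k. sqrt pi * norm (of_real (cbw k) * complex_of_real (norm h) ^ k))" by (rule summable_mult)
    moreover have "integral\<^sup>L lborel (\<lambda>x. norm (f k x)) = sqrt pi * norm (of_real (cbw k) * complex_of_real (norm h) ^ k)" for k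
      using has_bochner_integral_integral_eq[OF norm_int[of k]] cbw_pos[of k]
      by (simp add: norm_mult norm_power)
    ultimately show ?thesis by simp
  qed
  have int: "integrable lborel (f k)" for k using f_int has_bochner_integral_iff by blast
  have "integrable lborel (\<lambda>x. \<Sum>k. f k x)" "(\<lambda>k. integral\<^sup>L lborel (f k)) sums (\<integral>x. (\<Sum>k. f k x) \<partial>lborel)"
    by (rule integrable_suminf sums_integral; use int abs_sum norm_sum in auto)+
  moreover have "(\<lambda>x. \<Sum>k. f k x) = (\<lambda>x. exp (- b * of_real (x\<^sup>2)))"
    using sums by (simp add: sums_iff fun_eq_iff)
  moreover have "(\<lambda>k. integral\<^sup>L lborel (f k)) sums (of_real (sqrt pi) * b powr (-1/2))"
  proof -
    have "integral\<^sup>L lborel (f k) = of_real (sqrt pi) * (of_real (cbw k) * h ^ k)" for k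
      using has_bochner_integral_integral_eq[OF f_int[of k]] by simp
    moreover have "(\<lambda>k. of_real (sqrt pi) * (of_real (cbw k) * h ^ k)) sums (of_real (sqrt pi) * (1 - h) powr (-1/2))"
      by (intro sums_mult cbw_sums) (use assms in \<open>simp add: h_def\<close>)
    ultimately show ?thesis by (simp add: h_def)
  qed
  ultimately show ?thesis
    by (auto simp: has_bochner_integral_iff dest: sums_unique2)
qed

text \<open>
  The discs \<open>norm (s - a) < s\<close> with \<open>s > 0\<close> exhaust the right half-plane, so after rescaling the variable
  by \<open>sqrt s\<close> for a suitable \<open>s\<close> the previous case applies.
\<close>

lemma gaussian_integral_complex:
  fixes a :: complex
  assumes "Re a > 0"
  shows "has_bochner_integral lborel (\<lambda>x. exp (- a * of_real (x\<^sup>2))) (of_real (sqrt pi) / csqrt a)"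
proof -
  \<comment> \<open>Any \<open>s\<close> with \<open>2 * s * Re a > (norm a)\<^sup>2\<close> would do.\<close>
  define s where "s = (norm a)\<^sup>2 / Re a"
  have a0: "a \<noteq> 0" using assms by auto
  have s: "s > 0" using assms a0 by (simp add: s_def)
  define b where "b = a / of_real s"
  have ab: "a = b * of_real s" using s by (simp add: b_def)
  have "norm (1 - b) < 1"
  proof -
    have "(norm (of_real s - a))\<^sup>2 = s\<^sup>2 - 2 * s * Re a + (norm a)\<^sup>2"
      by (simp only: cmod_power2) (simp add: power2_eq_square algebra_simps)
    also have "(norm a)\<^sup>2 = s * Re a" using assms by (simp add: s_def)
    also have "s\<^sup>2 - 2 * s * Re a + s * Re a < s\<^sup>2" using mult_pos_pos[OF s assms] by simp
    finally have "norm (of_real s - a) < s" using s by (rule power_less_imp_less_base[OF _ less_imp_le])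
    moreover have "1 - b = (of_real s - a) / of_real s" using s by (simp add: b_def diff_divide_distrib)
    ultimately show ?thesis using s by (simp add: norm_divide)
  qed
  from gaussian_integral_disc[OF this]
  have "has_bochner_integral lborel (\<lambda>x. exp (- b * of_real ((0 + sqrt s * x)\<^sup>2)))
     ((of_real (sqrt pi) * b powr (-1/2)) /\<^sub>R \<bar>sqrt s\<bar>)"
    using s by (intro iffD1[OF lborel_has_bochner_integral_real_affine_iff[of "sqrt s" _ _ 0]]) simp_all
  also have "(\<lambda>x. exp (- b * of_real ((0 + sqrt s * x)\<^sup>2))) = (\<lambda>x. exp (- a * of_real (x\<^sup>2)))"
  proof
    fix x :: real
    have "(0 + sqrt s * x)\<^sup>2 = s * x\<^sup>2" using s by (simp add: power_mult_distrib)
    thus "exp (- b * of_real ((0 + sqrt s * x)\<^sup>2)) = exp (- a * of_real (x\<^sup>2))"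
      by (simp only: ab of_real_mult mult_minus_left mult.assoc)
  qed
  also have "(of_real (sqrt pi) * b powr (-1/2)) /\<^sub>R \<bar>sqrt s\<bar> = of_real (sqrt pi) / csqrt a"
  proof -
    have "a powr (1/2) = of_real s powr (1/2) * b powr (1/2)"
      unfolding ab mult.commute[of b] using s by (intro powr_times_real_left) auto
    also have "of_real s powr (1/2) = complex_of_real (sqrt s)"
      using s powr_of_real[of s "1/2"] by (simp add: powr_half_sqrt)
    finally have e1: "csqrt a = of_real (sqrt s) * b powr (1/2)" using a0 by (simp add: csqrt_conv_powr)
    have e2: "b powr (-1/2) = inverse (b powr (1/2))"
      using powr_minus[of b "1/2"] by simp
    have e3: "\<bar>sqrt s\<bar> = sqrt s" using s by simp
    define B where "B = inverse (b powr (1/2))"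
    have e1': "inverse (csqrt a) = inverse (of_real (sqrt s)) * B"
      unfolding e1 B_def by (rule inverse_mult_distrib)
    show ?thesis unfolding e2 e3 B_def[symmetric]
      unfolding divide_inverse[of _ "csqrt a"] e1' scaleR_conv_of_real inverse_mult_distrib of_real_inverse
      by (simp only: mult_ac)
  qed
  finally show ?thesis .
qed

section \<open>The integral representation\<close>

lemma fourier_orthogonality:
  fixes m :: int
  shows "has_bochner_integral lborel (\<lambda>x. indicator {-pi..pi} x *\<^sub>R exp (\<i> * of_int m * of_real x))
           (if m = 0 then 2 * of_real pi else 0)"
proof (cases "m = 0")
  case True
  have "has_bochner_integral lborel (\<lambda>x. indicator {-pi..pi} x *\<^sub>R (1::complex)) (of_real pi - of_real (-pi))"
    by (rule has_bochner_integral_FTC_Icc)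
       (auto intro!: derivative_eq_intros has_vector_derivative_of_real)
  thus ?thesis using True by simp
next
  case False
  define F where "F = (\<lambda>x. exp (\<i> * of_int m * of_real x) / (\<i> * of_int m))"
  have "has_bochner_integral lborel (\<lambda>x. indicator {-pi..pi} x *\<^sub>R exp (\<i> * of_int m * of_real x)) (F pi - F (-pi))"
  proof (rule has_bochner_integral_FTC_Icc)
    fix x :: real
    have "((\<lambda>z. exp (\<i> * of_int m * z) / (\<i> * of_int m)) has_field_derivative exp (\<i> * of_int m * of_real x)) (at (of_real x))"
      using False by (auto intro!: derivative_eq_intros)
    thus "(F has_vector_derivative exp (\<i> * of_int m * of_real x)) (at x within {-pi..pi})"
      unfolding F_def by (rule has_vector_derivative_real_field)
  qed (auto intro!: continuous_intros)
  moreover have "F pi = F (-pi)"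
  proof -
    have "exp (\<i> * of_int m * of_real pi) = exp (\<i> * of_int m * of_real (-pi))"
      unfolding exp_eq by (intro exI[of _ m]) (simp add: algebra_simps)
    thus ?thesis by (simp add: F_def)
  qed
  ultimately show ?thesis using False by simp
qed

text \<open>
  Squaring the coefficients of a polynomial is a Hadamard product, which is Parseval's formula on the
  circle of radius \<open>norm w\<close>.
\<close>

lemma apery_integral:
  "has_bochner_integral lborel
     (\<lambda>x. indicator {-pi..pi} x *\<^sub>R (shifted_legendre n (w * exp (\<i> * of_real x)) * shifted_legendre n (w * exp (- (\<i> * of_real x)))))
     (2 * of_real pi * poly (apery_poly n) (w\<^sup>2))"
proof -
  define a where "a = (\<lambda>k. of_nat ((n choose k) * ((n + k) choose k)) :: complex)"
  have "has_bochner_integral lborel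
     (\<lambda>x. \<Sum>j\<le>n. \<Sum>k\<le>n. (a j * a k * w ^ (j + k)) * (indicator {-pi..pi} x *\<^sub>R exp (\<i> * of_int (int j - int k) * of_real x)))
     (\<Sum>j\<le>n. \<Sum>k\<le>n. (a j * a k * w ^ (j + k)) * (if int j - int k = 0 then 2 * of_real pi else 0))"
    by (intro has_bochner_integral_sum has_bochner_integral_mult_right fourier_orthogonality)
  also have "(\<lambda>x. \<Sum>j\<le>n. \<Sum>k\<le>n. (a j * a k * w ^ (j + k)) * (indicator {-pi..pi} x *\<^sub>R exp (\<i> * of_int (int j - int k) * of_real x)))
    = (\<lambda>x. indicator {-pi..pi} x *\<^sub>R (shifted_legendre n (w * exp (\<i> * of_real x)) * shifted_legendre n (w * exp (- (\<i> * of_real x)))))"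
  proof
    fix x :: real
    have "shifted_legendre n (w * exp (\<i> * of_real x)) * shifted_legendre n (w * exp (- (\<i> * of_real x)))
       = (\<Sum>j\<le>n. \<Sum>k\<le>n. (a j * (w * exp (\<i> * of_real x)) ^ j) * (a k * (w * exp (- (\<i> * of_real x))) ^ k))"
      by (simp only: shifted_legendre_def a_def sum_product)
    also have "\<dots> = (\<Sum>j\<le>n. \<Sum>k\<le>n. (a j * a k * w ^ (j + k)) * exp (\<i> * of_int (int j - int k) * of_real x))"
    proof (intro sum.cong refl)
      fix j k
      have "exp (\<i> * of_int (int j - int k) * of_real x) = exp (\<i> * of_real x) ^ j * exp (- (\<i> * of_real x)) ^ k"
        unfolding exp_of_nat_mult[symmetric] exp_add[symmetric] by (simp add: algebra_simps)
      thus "(a j * (w * exp (\<i> * of_real x)) ^ j) * (a k * (w * exp (- (\<i> * of_real x))) ^ k)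
         = (a j * a k * w ^ (j + k)) * exp (\<i> * of_int (int j - int k) * of_real x)"
        by (simp add: power_mult_distrib power_add)
    qed
    finally show "(\<Sum>j\<le>n. \<Sum>k\<le>n. (a j * a k * w ^ (j + k)) * (indicator {-pi..pi} x *\<^sub>R exp (\<i> * of_int (int j - int k) * of_real x)))
      = indicator {-pi..pi} x *\<^sub>R (shifted_legendre n (w * exp (\<i> * of_real x)) * shifted_legendre n (w * exp (- (\<i> * of_real x))))"
      by (simp add: scaleR_sum_right)
  qed
  also have "(\<Sum>j\<le>n. \<Sum>k\<le>n. (a j * a k * w ^ (j + k)) * (if int j - int k = 0 then 2 * of_real pi else 0))
    = 2 * of_real pi * poly (apery_poly n) (w\<^sup>2)"
  proof -
    have "(\<Sum>j\<le>n. \<Sum>k\<le>n. (a j * a k * w ^ (j + k)) * (if int j - int k = 0 then 2 * of_real pi else 0))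
       = (\<Sum>j\<le>n. \<Sum>k\<le>n. if j = k then 2 * of_real pi * (a j * a j * w ^ (j + j)) else 0)"
      by (intro sum.cong refl) auto
    also have "\<dots> = (\<Sum>j\<le>n. 2 * of_real pi * (a j * a j * w ^ (j + j)))"
      by (intro sum.cong refl) (simp add: sum.delta')
    also have "\<dots> = 2 * of_real pi * poly (apery_poly n) (w\<^sup>2)"
      by (simp add: apery_poly_def poly_sum poly_monom a_def sum_distrib_left power2_eq_square power_add power_mult_distrib mult_ac)
    finally show ?thesis .
  qed
  finally show ?thesis .
qed

section \<open>Laplace's method\<close>

text \<open>
  The constant is far from optimal; it comes from \<open>\<bar>sin y\<bar> \<ge> \<bar>y\<bar> / 3\<close> for \<open>\<bar>y\<bar> \<le> pi / 2\<close>, which needs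
  nothing sharper than \<open>pi < 4\<close>.
\<close>

lemma one_minus_cos_ge:
  assumes "\<bar>x\<bar> \<le> pi"
  shows "x\<^sup>2 / 18 \<le> 1 - cos x"
proof -
  define y where "y = x / 2"
  have y: "\<bar>y\<bar> \<le> pi / 2" using assms by (simp add: y_def)
  have "\<bar>sin y - (\<Sum>m<3. sin_coeff m * y ^ m)\<bar> \<le> inverse (fact 3) * \<bar>y\<bar> ^ 3"
    by (rule Maclaurin_sin_bound)
  hence "\<bar>sin y - y\<bar> \<le> \<bar>y\<bar> ^ 3 / 6"
    by (simp add: sin_coeff_def eval_nat_numeral)
  moreover have "\<bar>y\<bar> ^ 3 / 6 \<le> 2 / 3 * \<bar>y\<bar>"
  proof -
    have "\<bar>y\<bar> \<le> 2" using y pi_less_4 by linarith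
    hence "\<bar>y\<bar>\<^sup>2 \<le> 2\<^sup>2" by (rule power_mono) simp
    hence "\<bar>y\<bar> * \<bar>y\<bar>\<^sup>2 \<le> \<bar>y\<bar> * 4" by (intro mult_left_mono) auto
    thus ?thesis by (simp add: power2_eq_square power3_eq_cube)
  qed
  ultimately have "\<bar>y / 3\<bar> \<le> \<bar>sin y\<bar>" by linarith
  hence "(y / 3)\<^sup>2 \<le> (sin y)\<^sup>2" by (simp only: abs_le_square_iff)
  moreover have "1 - cos x = 2 * (sin y)\<^sup>2"
    using cos_double_sin[of y] by (simp add: y_def)
  ultimately show ?thesis by (simp add: y_def power2_eq_square)
qed

lemma integrable_gaussian_weight:
  assumes "\<kappa> > 0"
  shows "integrable lborel (\<lambda>t::real. (A + B * t\<^sup>2) * exp (- \<kappa> * t\<^sup>2))"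
proof -
  have *: "integrable lborel (\<lambda>t::real. exp (- (sqrt \<kappa> * t)\<^sup>2) * (sqrt \<kappa> * t) ^ (2 * k))" for k
  proof -
    have "integrable lborel (\<lambda>t::real. exp (- t\<^sup>2) * t ^ (2 * k))"
      using gaussian_even_moment has_bochner_integral_iff by blast
    thus ?thesis
      using lborel_integrable_real_affine[of "\<lambda>t. exp (- t\<^sup>2) * t ^ (2 * k)" "sqrt \<kappa>" 0] assms by simp
  qed
  have sq: "(sqrt \<kappa> * t)\<^sup>2 = \<kappa> * t\<^sup>2" for t using assms by (simp add: power_mult_distrib)
  have "integrable lborel (\<lambda>t. A * (exp (- (sqrt \<kappa> * t)\<^sup>2) * (sqrt \<kappa> * t) ^ (2 * 0))
          + (B / \<kappa>) * (exp (- (sqrt \<kappa> * t)\<^sup>2) * (sqrt \<kappa> * t) ^ (2 * 1)))"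
    by (intro Bochner_Integration.integrable_add integrable_mult_right *)
  also have "(\<lambda>t. A * (exp (- (sqrt \<kappa> * t)\<^sup>2) * (sqrt \<kappa> * t) ^ (2 * 0))
          + (B / \<kappa>) * (exp (- (sqrt \<kappa> * t)\<^sup>2) * (sqrt \<kappa> * t) ^ (2 * 1))) =
     (\<lambda>t. (A + B * t\<^sup>2) * exp (- \<kappa> * t\<^sup>2))"
    using assms by (simp only: mult_1_right sq mult_0_right power_0) (simp add: fun_eq_iff algebra_simps)
  finally show ?thesis .
qed

text \<open>
  The constant in the form in which Laplace's method produces it: the Gaussian integral, the product of
  two Legendre prefactors, and the normalization of the integral representation.
\<close>

definition apery_limit_const :: "complex \<Rightarrow> complex" where
  "apery_limit_const w = of_real (sqrt pi) / csqrt (w\<^sup>2 / (2 * crit_root w ^ 3))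
     / (1 - 1 / (joukowski w)\<^sup>2) / (2 * of_real pi ^ 2)"

text \<open>
  Add the two tangent inequalities at \<open>w * exp (\<i>x)\<close> and \<open>w * exp (-\<i>x)\<close>: the real parts sum to
  \<open>2 * Re w * cos x\<close>, the imaginary part of \<open>w\<close> drops out, and \<open>Re w > 0\<close> makes the exponent negative.
\<close>

lemma growth_product_decay:
  assumes w: "Re w > 0"
  obtains \<kappa> where "\<kappa> > 0"
    "\<And>x. \<bar>x\<bar> \<le> pi \<Longrightarrow> growth (w * exp (\<i> * of_real x)) * growth (w * exp (- (\<i> * of_real x)))
        \<le> (growth w)\<^sup>2 * exp (- \<kappa> * x\<^sup>2)"
proof -
  define l where "l = 1 / (norm (w + 1) * sinh (arcosh (norm w + norm (w + 1))))"
  have w1: "norm (w + 1) > 1" using complex_Re_le_cmod[of "w + 1"] w by simp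
  have gt: "norm w + norm (w + 1) > 1" using w1 norm_ge_zero[of w] by linarith
  have wm: "w \<noteq> -1" using w by auto
  have "arcosh (norm w + norm (w + 1)) > 0" using gt by simp
  hence "sinh (arcosh (norm w + norm (w + 1))) > 0" by (simp only: sinh_real_pos_iff)
  hence l: "l > 0" unfolding l_def using w1 by (intro divide_pos_pos mult_pos_pos) auto
  show ?thesis
  proof (rule that)
    show "l * Re w / 9 > 0" using l w by simp
    fix x :: real assume x: "\<bar>x\<bar> \<le> pi"
    have nrm: "norm (w * exp (\<i> * of_real x)) = norm w" "norm (w * exp (- (\<i> * of_real x))) = norm w"
      by (simp_all add: norm_mult)
    have "growth (w * exp (\<i> * of_real x)) * growth (w * exp (- (\<i> * of_real x))) \<le>
       (growth w * exp (l * (Re (w * exp (\<i> * of_real x)) - Re w))) *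
       (growth w * exp (l * (Re (w * exp (- (\<i> * of_real x))) - Re w)))"
      using growth_le_exp_Re[OF nrm(1) gt wm] growth_le_exp_Re[OF nrm(2) gt wm] growth_ge_1[THEN order_trans[OF zero_le_one]]
      unfolding l_def[symmetric] by (intro mult_mono mult_nonneg_nonneg exp_ge_zero)
    also have "\<dots> = (growth w)\<^sup>2 * exp (l * (Re (w * exp (\<i> * of_real x)) + Re (w * exp (- (\<i> * of_real x))) - 2 * Re w))"
      by (simp add: power2_eq_square exp_add[symmetric] algebra_simps)
    also have "Re (w * exp (\<i> * of_real x)) + Re (w * exp (- (\<i> * of_real x))) = 2 * Re w * cos x"
      by (simp add: Re_exp Im_exp)
    also have "(growth w)\<^sup>2 * exp (l * (2 * Re w * cos x - 2 * Re w)) \<le> (growth w)\<^sup>2 * exp (- (l * Re w / 9) * x\<^sup>2)"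
    proof -
      have "(2 * l * Re w) * (x\<^sup>2 / 18) \<le> (2 * l * Re w) * (1 - cos x)"
        using one_minus_cos_ge[OF x] l w by (intro mult_left_mono) auto
      thus ?thesis by (intro mult_left_mono) (simp_all add: algebra_simps)
    qed
    finally show "growth (w * exp (\<i> * of_real x)) * growth (w * exp (- (\<i> * of_real x)))
        \<le> (growth w)\<^sup>2 * exp (- (l * Re w / 9) * x\<^sup>2)" .
  qed
qed

text \<open>
  After the substitution \<open>x = t / sqrt n\<close> the integrand, divided by \<open>joukowski w ^ (2n)\<close> and multiplied by
  \<open>n\<close>, converges pointwise to a Gaussian. The dominating function has two sources. For \<open>\<bar>x\<bar> < \<delta>\<close> both
  Legendre polynomials carry a factor \<open>1 / sqrt n\<close> and the factor \<open>n\<close> is absorbed. For \<open>\<bar>x\<bar> \<ge> \<delta>\<close> the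
  arguments may approach the segment between the foci and this gain is lost, but there
  \<open>n \<le> t\<^sup>2 / \<delta>\<^sup>2\<close>, which is harmless against the Gaussian decay.
\<close>

lemma apery_poly_limit:
  assumes w: "Re w > 0"
  shows "(\<lambda>n. of_real (real n * sqrt (real n)) * poly (apery_poly n) (w\<^sup>2) / joukowski w ^ (2 * n))
           \<longlonglongrightarrow> apery_limit_const w"
proof -
  define u where "u = (\<lambda>x::real. w * exp (\<i> * of_real x))"
  have u_minus: "u (- x) = w * exp (- (\<i> * of_real x))" for x by (simp add: u_def)
  have "continuous_on UNIV u" unfolding u_def by (intro continuous_intros)
  hence u_cont: "isCont u 0" by (simp add: continuous_on_eq_continuous_at)
  define g where "g = joukowski w"
  define a where "a = w\<^sup>2 / (2 * crit_root w ^ 3)"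
  define q where "q = 1 / (1 - 1 / g\<^sup>2) / of_real pi"
  have g: "norm g > 1" "g \<noteq> 0" using norm_joukowski_gt_1[OF w] joukowski_nonzero by (auto simp: g_def)
  have gr: "growth w = norm g" using growth_eq_norm_joukowski[OF w] by (simp add: g_def)
  have nz: "1 - 1 / g\<^sup>2 \<noteq> 0"
  proof
    assume "1 - 1 / g\<^sup>2 = 0"
    hence "g\<^sup>2 = 1" using g by (simp add: field_simps)
    hence "norm g ^ 2 = 1" by (metis norm_power norm_one)
    thus False using g(1) by (simp add: power2_eq_1_iff)
  qed
  obtain \<kappa> where \<kappa>: "\<kappa> > 0" and
    decay0: "\<And>x. \<bar>x\<bar> \<le> pi \<Longrightarrow> growth (w * exp (\<i> * of_real x)) * growth (w * exp (- (\<i> * of_real x)))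
        \<le> (growth w)\<^sup>2 * exp (- \<kappa> * x\<^sup>2)"
    by (rule growth_product_decay[OF w]) blast
  have decay: "growth (u x) * growth (u (- x)) \<le> (norm g)\<^sup>2 * exp (- \<kappa> * x\<^sup>2)" if "\<bar>x\<bar> \<le> pi" for x
    using decay0[OF that] unfolding u_minus gr unfolding u_def .
  obtain \<delta> where \<delta>: "\<delta> > 0" "\<delta> \<le> pi" "\<And>x. \<bar>x\<bar> < \<delta> \<Longrightarrow> Re (u x) > 0"
  proof -
    have "isCont (\<lambda>x. Re (u x)) 0" using u_cont by (rule isCont_Re)
    hence "((\<lambda>x. Re (u x)) \<longlongrightarrow> Re w) (nhds 0)"
      by (simp add: isCont_def tendsto_nhds_iff u_def)
    hence "eventually (\<lambda>x. Re (u x) > 0) (nhds 0)"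
      using w by (rule order_tendstoD)
    then obtain d where "d > 0" "\<And>x. \<bar>x\<bar> < d \<Longrightarrow> Re (u x) > 0"
      by (auto simp: eventually_nhds_metric dist_norm)
    thus ?thesis using that[of "min d pi"] by simp
  qed
  define r where "r = 1 / (1 + norm w)\<^sup>2"
  define C where "C = (\<Sum>k. (real k + 1) * r ^ k)"
  have r: "0 \<le> r" "r < 1"
    using w by (auto simp: r_def power2_eq_square add_pos_nonneg intro!: less_1_mult)
  have C: "C \<ge> 0" unfolding C_def using r by (intro suminf_nonneg summable_linear_times_power) auto
  have leg_bound: "sqrt (real n) * norm (shifted_legendre n (u x)) \<le> C * growth (u x) ^ n" if "\<bar>x\<bar> < \<delta>" for n x
    unfolding C_def
  proof (rule norm_sqrt_legendre_le[OF r(2)])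
    have "1 \<le> norm (u x + 1)"
      using complex_Re_le_cmod[of "u x + 1"] \<delta>(3)[OF that] by simp
    hence "1 + norm w \<le> growth (u x)"
      using focal_sum_le_growth[of "u x"] by (simp add: u_def norm_mult)
    moreover have pos: "0 < 1 + norm w" by (simp add: add_pos_nonneg)
    ultimately have "(1 + norm w)\<^sup>2 \<le> (growth (u x))\<^sup>2" "0 < (growth (u x))\<^sup>2"
      by (auto intro!: power_mono zero_less_power)
    thus "1 / (growth (u x))\<^sup>2 \<le> r"
      unfolding r_def using pos growth_ge_1[of "u x"] by (intro divide_left_mono mult_pos_pos zero_less_power) auto
  qed
  define P where "P = (\<lambda>n x. shifted_legendre n (u x) * shifted_legendre n (u (- x)))"
  define s where "s = (\<lambda>n t. (of_nat n / g ^ (2 * n)) * (indicator {-pi..pi} (t / sqrt (real n)) *\<^sub>R P n (t / sqrt (real n))))"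
  define W where "W = (\<lambda>t. (C\<^sup>2 + (1 / \<delta>\<^sup>2) * t\<^sup>2) * exp (- \<kappa> * t\<^sup>2))"
  have s_int: "has_bochner_integral lborel (s n)
     (2 * of_real pi * (of_real (real n * sqrt (real n)) * poly (apery_poly n) (w\<^sup>2) / g ^ (2 * n)))" for n
  proof (cases "n = 0")
    case False
    have "has_bochner_integral lborel
       (\<lambda>t. indicator {-pi..pi} (0 + (1 / sqrt (real n)) * t) *\<^sub>R P n (0 + (1 / sqrt (real n)) * t))
       ((2 * of_real pi * poly (apery_poly n) (w\<^sup>2)) /\<^sub>R \<bar>1 / sqrt (real n)\<bar>)"
      by (rule iffD1[OF lborel_has_bochner_integral_real_affine_iff])
         (use False apery_integral[of n w] in \<open>simp_all add: P_def u_minus u_def\<close>)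
    hence "has_bochner_integral lborel (s n) ((of_nat n / g ^ (2 * n)) *
         ((2 * of_real pi * poly (apery_poly n) (w\<^sup>2)) /\<^sub>R \<bar>1 / sqrt (real n)\<bar>))"
      unfolding s_def by (intro has_bochner_integral_mult_right) simp
    thus ?thesis by (simp add: scaleR_conv_of_real mult_ac)
  qed (simp add: s_def has_bochner_integral_zero)
  have s_bound: "norm (s n t) \<le> W t" for n t
  proof (cases "n = 0 \<or> \<bar>t / sqrt (real n)\<bar> > pi")
    case True
    have "W t \<ge> 0" by (simp add: W_def)
    moreover have "s n t = 0" using True by (auto simp: s_def indicator_def abs_le_iff)
    ultimately show ?thesis by simp
  next
    case False
    define x where "x = t / sqrt (real n)"
    have n: "n > 0" and x: "\<bar>x\<bar> \<le> pi" using False by (auto simp: x_def)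
    have t: "t\<^sup>2 = real n * x\<^sup>2" using n by (simp add: x_def power_divide)
    have s_norm: "norm (s n t) = real n * norm (P n x) / norm g ^ (2 * n)"
    proof -
      have "x \<in> {-pi..pi}" using x by auto
      thus ?thesis by (simp add: s_def x_def[symmetric] norm_mult norm_divide norm_power)
    qed
    have gg: "(growth (u x) * growth (u (- x))) ^ n \<le> norm g ^ (2 * n) * exp (- \<kappa> * t\<^sup>2)"
    proof -
      have "(growth (u x) * growth (u (- x))) ^ n \<le> ((norm g)\<^sup>2 * exp (- \<kappa> * x\<^sup>2)) ^ n"
        using decay[OF x] growth_ge_1[of "u x"] growth_ge_1[of "u (- x)"]
        by (intro power_mono) (auto intro!: mult_nonneg_nonneg)
      also have "\<dots> = norm g ^ (2 * n) * exp (- \<kappa> * t\<^sup>2)"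
        by (simp add: power_mult_distrib power_mult[symmetric] exp_of_nat_mult[symmetric] t mult_ac)
      finally show ?thesis .
    qed
    have "real n * norm (P n x) \<le> (C\<^sup>2 + (1 / \<delta>\<^sup>2) * t\<^sup>2) * (growth (u x) * growth (u (- x))) ^ n"
    proof (cases "\<bar>x\<bar> < \<delta>")
      case True
      have "real n * norm (P n x) = (sqrt (real n) * norm (shifted_legendre n (u x))) * (sqrt (real n) * norm (shifted_legendre n (u (- x))))"
        by (simp add: P_def norm_mult)
      also have "\<dots> \<le> (C * growth (u x) ^ n) * (C * growth (u (- x)) ^ n)"
      proof (rule mult_mono)
        show "sqrt (real n) * norm (shifted_legendre n (u x)) \<le> C * growth (u x) ^ n"
          using True by (rule leg_bound)
        show "sqrt (real n) * norm (shifted_legendre n (u (- x))) \<le> C * growth (u (- x)) ^ n"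
          using True by (intro leg_bound) simp
        show "0 \<le> C * growth (u x) ^ n" using C growth_ge_1[of "u x"] by simp
      qed simp
      also have "\<dots> = C\<^sup>2 * (growth (u x) * growth (u (- x))) ^ n"
        by (simp add: power2_eq_square power_mult_distrib)
      also have "\<dots> \<le> (C\<^sup>2 + (1 / \<delta>\<^sup>2) * t\<^sup>2) * (growth (u x) * growth (u (- x))) ^ n"
        using growth_ge_1[of "u x"] growth_ge_1[of "u (- x)"] by (intro mult_right_mono) auto
      finally show ?thesis .
    next
      case False
      hence "\<delta>\<^sup>2 \<le> x\<^sup>2" using \<delta>(1) power_mono[of \<delta> "\<bar>x\<bar>" 2] by simp
      hence "real n * \<delta>\<^sup>2 \<le> t\<^sup>2" unfolding t by (rule mult_left_mono) simp
      hence "real n \<le> (1 / \<delta>\<^sup>2) * t\<^sup>2" using \<delta>(1) by (simp add: field_simps)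
      hence 1: "real n \<le> C\<^sup>2 + (1 / \<delta>\<^sup>2) * t\<^sup>2" by (simp add: add_increasing)
      have 2: "norm (P n x) \<le> (growth (u x) * growth (u (- x))) ^ n"
        unfolding P_def norm_mult power_mult_distrib
        using norm_legendre_le_growth growth_ge_1[of "u x"] by (intro mult_mono) auto
      show ?thesis using 1 2 by (intro mult_mono) auto
    qed
    also have "\<dots> \<le> (C\<^sup>2 + (1 / \<delta>\<^sup>2) * t\<^sup>2) * (norm g ^ (2 * n) * exp (- \<kappa> * t\<^sup>2))"
      using gg by (intro mult_left_mono) auto
    finally have "real n * norm (P n x) \<le> W t * norm g ^ (2 * n)" by (simp add: W_def mult_ac)
    thus ?thesis unfolding s_norm using g by (simp add: divide_le_eq)
  qed
  have x_lim: "(\<lambda>n. t / sqrt (real n)) \<longlonglongrightarrow> 0" for t by real_asymp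
  have u_lim: "(\<lambda>n. u (t / sqrt (real n))) \<longlonglongrightarrow> w" for t
  proof -
    from isCont_tendsto_compose[OF u_cont x_lim] show ?thesis by (simp add: u_def)
  qed
  define J where "J = (\<lambda>t n. (joukowski (u (t / sqrt (real n))) * joukowski (u (- (t / sqrt (real n)))) / g\<^sup>2) ^ n)"
  have J_lim: "J t \<longlonglongrightarrow> exp (- a * of_real (t\<^sup>2))" for t
    using phase_limit[OF w, of t] unfolding J_def u_minus unfolding u_def a_def g_def .
  have s_lim: "(\<lambda>n. s n t) \<longlonglongrightarrow> q * exp (- a * of_real (t\<^sup>2))" for t
  proof -
    define Q where "Q = (\<lambda>t n. of_real (sqrt (real n)) * shifted_legendre n (u (t / sqrt (real n))) / joukowski (u (t / sqrt (real n))) ^ n)"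
    have Q: "Q t \<longlonglongrightarrow> (1 - 1 / g\<^sup>2) powr (-1/2) / of_real (sqrt pi)" for t
      unfolding Q_def g_def by (rule legendre_asymptotic[OF u_lim w])
    have "(\<lambda>n. Q t n * Q (- t) n * J t n) \<longlonglongrightarrow>
       ((1 - 1 / g\<^sup>2) powr (-1/2) / of_real (sqrt pi)) * ((1 - 1 / g\<^sup>2) powr (-1/2) / of_real (sqrt pi)) * exp (- a * of_real (t\<^sup>2))"
      by (intro tendsto_mult Q J_lim)
    also have "((1 - 1 / g\<^sup>2) powr (-1/2) / of_real (sqrt pi)) * ((1 - 1 / g\<^sup>2) powr (-1/2) / of_real (sqrt pi)) = q"
    proof -
      have "(1 - 1 / g\<^sup>2) powr (-1/2) * (1 - 1 / g\<^sup>2) powr (-1/2) = (1 - 1 / g\<^sup>2) powr (-1)"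
        unfolding powr_add[symmetric] by simp
      also have "\<dots> = 1 / (1 - 1 / g\<^sup>2)" using nz by (simp add: powr_minus inverse_eq_divide)
      finally have 1: "(1 - 1 / g\<^sup>2) powr (-1/2) * (1 - 1 / g\<^sup>2) powr (-1/2) = 1 / (1 - 1 / g\<^sup>2)" .
      have 2: "of_real (sqrt pi) * of_real (sqrt pi) = complex_of_real pi"
        unfolding of_real_mult[symmetric] by simp
      show ?thesis unfolding times_divide_times_eq 1 2 q_def ..
    qed
    finally have lim: "(\<lambda>n. Q t n * Q (- t) n * J t n) \<longlonglongrightarrow> q * exp (- a * of_real (t\<^sup>2))" .
    have "eventually (\<lambda>n. \<bar>t / sqrt (real n)\<bar> < pi) sequentially"
      using tendsto_rabs[OF x_lim[of t]] by (rule order_tendstoD) simp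
    hence "eventually (\<lambda>n. Q t n * Q (- t) n * J t n = s n t) sequentially"
    proof eventually_elim
      case (elim n)
      hence "t / sqrt (real n) \<in> {-pi..pi}" unfolding atLeastAtMost_iff abs_less_iff by linarith
      moreover have "complex_of_real (sqrt (real n)) * of_real (sqrt (real n)) = of_nat n"
        unfolding of_real_mult[symmetric] by simp
      ultimately show ?case
        using joukowski_nonzero[of "u (t / sqrt (real n))"] joukowski_nonzero[of "u (- (t / sqrt (real n)))"] g(2)
        by (simp add: Q_def J_def s_def P_def power_divide power_mult_distrib power_mult[symmetric] mult_ac)
    qed
    with lim show ?thesis by (rule Lim_transform_eventually)
  qed
  \<comment> \<open>The decay estimate survives the limit, so the limiting Gaussian is integrable.\<close>
  have Re_a: "Re a > 0"
  proof -
    have "norm (exp (- a * of_real (1\<^sup>2))) \<le> exp (- \<kappa>)"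
    proof (rule tendsto_upperbound)
      show "(\<lambda>n. norm (J 1 n)) \<longlonglongrightarrow> norm (exp (- a * of_real (1\<^sup>2)))"
        by (intro tendsto_norm J_lim)
      have "eventually (\<lambda>n. \<bar>1 / sqrt (real n)\<bar> < \<delta>) sequentially"
        using tendsto_rabs[OF x_lim[of 1]] \<delta>(1) by (intro order_tendstoD) auto
      thus "eventually (\<lambda>n. norm (J 1 n) \<le> exp (- \<kappa>)) sequentially"
        using eventually_gt_at_top[of 0]
      proof eventually_elim
        case (elim n)
        define x where "x = 1 / sqrt (real n)"
        have x: "\<bar>x\<bar> < \<delta>" using elim by (simp add: x_def)
        have J: "J 1 n = (joukowski (u x) * joukowski (u (- x)) / g\<^sup>2) ^ n" by (simp add: J_def x_def)
        have "norm (joukowski (u x) * joukowski (u (- x)) / g\<^sup>2) = growth (u x) * growth (u (- x)) / (norm g)\<^sup>2"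
          using growth_eq_norm_joukowski[of "u x"] growth_eq_norm_joukowski[of "u (- x)"] \<delta>(3)[of x] \<delta>(3)[of "- x"] x
          by (simp add: norm_mult norm_divide norm_power)
        also have "\<dots> \<le> exp (- \<kappa> * x\<^sup>2)"
          using decay[of x] x \<delta>(2) g by (simp add: divide_le_eq mult.commute)
        finally have "norm (J 1 n) \<le> exp (- \<kappa> * x\<^sup>2) ^ n"
          unfolding J norm_power by (intro power_mono) auto
        also have "\<dots> = exp (- \<kappa>)"
          using elim by (simp add: exp_of_nat_mult[symmetric] x_def power_divide)
        finally show ?case .
      qed
    qed simp
    thus ?thesis using \<kappa> by simp
  qed
  have "(\<lambda>n. integral\<^sup>L lborel (s n)) \<longlonglongrightarrow> integral\<^sup>L lborel (\<lambda>t. q * exp (- a * of_real (t\<^sup>2)))"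
  proof (rule integral_dominated_convergence[where w = W])
    show "(\<lambda>t. q * exp (- a * of_real (t\<^sup>2))) \<in> borel_measurable lborel"
      using gaussian_integral_complex[OF Re_a] by (intro borel_measurable_times) (auto dest: borel_measurable_has_bochner_integral)
    show "s n \<in> borel_measurable lborel" for n
      using s_int[of n] by (rule borel_measurable_has_bochner_integral)
    show "integrable lborel W" unfolding W_def by (rule integrable_gaussian_weight[OF \<kappa>])
  qed (use s_lim s_bound in auto)
  also have "integral\<^sup>L lborel (\<lambda>t. q * exp (- a * of_real (t\<^sup>2))) = q * (of_real (sqrt pi) / csqrt a)"
    by (rule has_bochner_integral_integral_eq[OF has_bochner_integral_mult_right[OF gaussian_integral_complex[OF Re_a]]])
  also have "(\<lambda>n. integral\<^sup>L lborel (s n)) = (\<lambda>n. 2 * of_real pi * (of_real (real n * sqrt (real n)) * poly (apery_poly n) (w\<^sup>2) / g ^ (2 * n)))"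
    by (intro ext has_bochner_integral_integral_eq s_int)
  finally have "(\<lambda>n. (2 * of_real pi * (of_real (real n * sqrt (real n)) * poly (apery_poly n) (w\<^sup>2) / g ^ (2 * n))) / (2 * of_real pi))
      \<longlonglongrightarrow> (q * (of_real (sqrt pi) / csqrt a)) / (2 * of_real pi)"
    by (rule tendsto_divide[OF _ tendsto_const]) simp
  moreover have "(q * (of_real (sqrt pi) / csqrt a)) / (2 * of_real pi) = apery_limit_const w"
    by (simp add: q_def apery_limit_const_def a_def g_def power2_eq_square mult_ac)
  ultimately show ?thesis by (simp add: g_def)
qed

section \<open>Identification of the constant\<close>

text \<open>
  In terms of \<open>l = Ln w\<close> and \<open>m = Ln (w + 1)\<close> the quotient is \<open>exp (3/4 * m - 1/4 * l)\<close>, and the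
  imaginary part of the exponent is below \<open>pi / 2\<close> in modulus because those of \<open>l\<close> and \<open>m\<close> are.
\<close>

lemma Re_crit_root_powr_div_pos:
  assumes w: "Re w > 0"
  shows "Re (crit_root w powr (3/2) / w) > 0"
proof -
  define l m where "l = Ln w" and "m = Ln (w + 1)"
  have nz: "w \<noteq> 0" "w + 1 \<noteq> 0" using w by (auto simp: add_eq_0_iff2)
  have im: "\<bar>Im l\<bar> < pi / 2" "\<bar>Im m\<bar> < pi / 2"
    unfolding l_def m_def using w by (intro Re_Ln_pos_lt_imp; simp)+
  have "w\<^sup>2 + w = exp (l + m)"
    using nz by (simp add: l_def m_def exp_add power2_eq_square algebra_simps)
  moreover have "Ln (exp (l + m)) = l + m" using im by (intro Ln_exp) auto
  ultimately have "crit_root w = exp ((l + m) / 2)"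
    unfolding crit_root_def by (simp add: csqrt_exp_Ln)
  moreover have "Ln (exp ((l + m) / 2)) = (l + m) / 2" using im by (intro Ln_exp) auto
  ultimately have "crit_root w powr (3/2) = exp (3/2 * ((l + m) / 2))"
    by (simp only: powr_def exp_not_eq_zero if_False)
  moreover have "w = exp l" using nz by (simp add: l_def)
  ultimately have "crit_root w powr (3/2) / w = exp (3/2 * ((l + m) / 2)) / exp l" by metis
  also have "\<dots> = exp (3/4 * m - 1/4 * l)"
    unfolding exp_diff[symmetric] by (rule arg_cong[of _ _ exp]) (simp add: field_simps)
  finally have *: "crit_root w powr (3/2) / w = exp (3/4 * m - 1/4 * l)" .
  have "cos (Im (3/4 * m - 1/4 * l)) > 0"
    using im by (intro cos_gt_zero_pi) auto
  thus ?thesis unfolding * Re_exp by simp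
qed

text \<open>
  Up to sign the identity is algebra, since all roots involved have known squares. The sign is the issue
  of branches: the principal root \<open>\<alpha>\<close> of \<open>w\<^sup>2 / (2 * r ^ 3)\<close> and the quotient \<open>r powr (3/2) / w\<close> have
  product \<open>\<plusminus>1 / sqrt 2\<close>, and both have nonnegative real part, the second one strictly, so the product
  cannot be negative.
\<close>

lemma apery_limit_const_eq:
  assumes w: "Re w > 0"
  shows "apery_limit_const w = (1 + w + crit_root w)\<^sup>2 / (2 * (of_real ((2 * pi) powr (3/2)) * crit_root w powr (3/2)))"
    and "apery_limit_const w \<noteq> 0"
proof -
  define r g where "r = crit_root w" and "g = joukowski w"
  define \<xi> where "\<xi> = r powr (3/2)"
  define \<alpha> where "\<alpha> = csqrt (w\<^sup>2 / (2 * r ^ 3))"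
  have nz: "w \<noteq> 0" "r \<noteq> 0" "g \<noteq> 0" "1 + w \<noteq> 0"
    using w crit_root_nonzero[OF w] joukowski_nonzero by (auto simp: r_def g_def complex_eq_iff[of _ 0])
  have r2: "r\<^sup>2 = w * (1 + w)" unfolding r_def crit_root_sq by (simp add: power2_eq_square algebra_simps)
  have \<xi>2: "\<xi>\<^sup>2 = r ^ 3"
  proof -
    have "\<xi>\<^sup>2 = r powr 3" unfolding \<xi>_def power2_eq_square powr_add[symmetric] by simp
    thus ?thesis using nz by simp
  qed
  have \<xi>: "\<xi> \<noteq> 0" using nz by (simp add: \<xi>_def)
  have \<alpha>2: "\<alpha>\<^sup>2 = w\<^sup>2 / (2 * \<xi>\<^sup>2)" by (simp add: \<alpha>_def \<xi>2)
  have \<eta>: "Re (\<xi> / w) > 0" using Re_crit_root_powr_div_pos[OF w] by (simp add: \<xi>_def r_def)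
  define s where "s = complex_of_real (sqrt 2)"
  have "s\<^sup>2 = of_real ((sqrt 2)\<^sup>2)" unfolding s_def by (simp only: of_real_power)
  hence s: "s\<^sup>2 = 2" by simp
  hence "s \<noteq> 0" by auto
  note s = s this
  have "(s * \<alpha> * (\<xi> / w))\<^sup>2 = 1"
    using nz \<xi> by (simp add: power_mult_distrib \<alpha>2 s power_divide)
  moreover have "s * \<alpha> * (\<xi> / w) \<noteq> -1"
  proof
    assume "s * \<alpha> * (\<xi> / w) = -1"
    hence e: "\<alpha> * (s * (\<xi> / w)) = -1" by (simp add: mult_ac)
    define \<beta> where "\<beta> = s * (\<xi> / w)"
    have \<beta>: "Re \<beta> > 0" using \<eta> by (simp add: \<beta>_def s_def del: times_divide_eq_right)
    define N where "N = (norm \<beta>)\<^sup>2"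
    have "\<alpha> * \<beta> * cnj \<beta> = - cnj \<beta>" using e by (simp add: \<beta>_def)
    hence "\<alpha> * of_real N = - cnj \<beta>" by (simp only: N_def mult.assoc complex_norm_square)
    hence "Re (\<alpha> * of_real N) = Re (- cnj \<beta>)" by (simp only:)
    hence "Re \<alpha> * N = - Re \<beta>" by simp
    moreover have "Re \<alpha> \<ge> 0" unfolding \<alpha>_def using csqrt_principal[of "w\<^sup>2 / (2 * r ^ 3)"] by linarith
    ultimately have "- Re \<beta> \<ge> 0" by (metis N_def mult_nonneg_nonneg zero_le_power2)
    thus False using \<beta> by simp
  qed
  ultimately have "s * \<alpha> * (\<xi> / w) = 1" by (simp add: power2_eq_1_iff)
  hence "\<alpha> * (s * \<xi> / w) = 1" by (simp add: mult_ac)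
  hence \<alpha>: "1 / \<alpha> = s * \<xi> / w" using inverse_unique by (metis inverse_eq_divide)
  have gq: "1 - 1 / g\<^sup>2 = 4 * r / g"
  proof -
    have "g * (1 - 1 / g\<^sup>2) = g - 1 / g" using nz by (simp add: power2_eq_square right_diff_distrib)
    also have "\<dots> = 4 * r" unfolding g_def inverse_joukowski by (simp add: joukowski_def r_def)
    finally show ?thesis using nz by (simp add: eq_divide_eq mult.commute)
  qed
  have num: "(1 + w + r)\<^sup>2 = (1 + w) * g"
  proof -
    have "(1 + w + r)\<^sup>2 = (1 + w)\<^sup>2 + 2 * (1 + w) * r + r\<^sup>2" by (simp add: power2_eq_square algebra_simps)
    thus ?thesis unfolding r2 g_def joukowski_def r_def[symmetric] by (simp add: power2_eq_square algebra_simps)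
  qed
  define p where "p = complex_of_real (sqrt pi)"
  have "p\<^sup>2 = of_real ((sqrt pi)\<^sup>2)" unfolding p_def by (simp only: of_real_power)
  hence p: "p\<^sup>2 = of_real pi" by simp
  hence "p \<noteq> 0" by auto
  note p = p this
  have pw: "complex_of_real ((2 * pi) powr (3/2)) = 2 * p\<^sup>2 * s * p"
  proof -
    have "(2 * pi) powr (3/2) = (2 * pi) powr (1 + 1/2)" by simp
    also have "\<dots> = (2 * pi) * sqrt (2 * pi)" by (subst powr_add) (simp add: powr_half_sqrt)
    finally show ?thesis unfolding p by (simp add: p_def s_def real_sqrt_mult)
  qed
  have "apery_limit_const w = p * (1 / \<alpha>) / (4 * r / g) / (2 * (p\<^sup>2)\<^sup>2)"
    unfolding p(1) by (simp add: apery_limit_const_def p_def \<alpha>_def r_def[symmetric] g_def[symmetric] gq)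
  also have "\<dots> = s * \<xi> * g / (8 * w * r * p ^ 3)"
    unfolding \<alpha> using nz p(2) by (simp add: power2_eq_square power3_eq_cube mult.assoc)
  finally have K: "apery_limit_const w = s * \<xi> * g / (8 * w * r * p ^ 3)" .
  show "apery_limit_const w \<noteq> 0" unfolding K using nz \<xi> s p by simp
  have "s * \<xi> * g / (8 * w * r * p ^ 3) = (1 + w) * g / (2 * (2 * p\<^sup>2 * s * p * \<xi>))"
  proof -
    have "s * \<xi> * g * (2 * (2 * p\<^sup>2 * s * p * \<xi>)) = 4 * s\<^sup>2 * \<xi>\<^sup>2 * g * p ^ 3"
      by (simp add: power2_eq_square power3_eq_cube)
    also have "\<dots> = 8 * (r * r\<^sup>2) * g * p ^ 3" unfolding \<xi>2 s by (simp add: power2_eq_square power3_eq_cube)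
    also have "\<dots> = (1 + w) * g * (8 * w * r * p ^ 3)" unfolding r2 by (simp add: mult_ac)
    finally show ?thesis using nz \<xi> s p by (simp add: frac_eq_eq)
  qed
  thus "apery_limit_const w = (1 + w + crit_root w)\<^sup>2 / (2 * (of_real ((2 * pi) powr (3/2)) * crit_root w powr (3/2)))"
    unfolding K pw r_def[symmetric] num \<xi>_def[symmetric] .
qed

lemma apery_poly_asymp_equiv:
  assumes "z \<notin> \<real>\<^sub>\<le>\<^sub>0"
  shows "(\<lambda>n. poly (apery_poly n) z) \<sim>[sequentially]
            (\<lambda>n. (1 + csqrt z + csqrt (z + csqrt z))\<^sup>2
                 / (2 * (2 * complex_of_real pi * of_nat n * csqrt (z + csqrt z)) powr (3 / 2))
                 * (1 + 2 * csqrt z + 2 * csqrt (z + csqrt z)) ^ (2 * n))"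
proof -
  define w where "w = csqrt z"
  have w: "Re w > 0" unfolding w_def by (rule Re_csqrt_pos[OF assms])
  have z: "z = w\<^sup>2" by (simp add: w_def)
  define r where "r = crit_root w"
  have r: "csqrt (z + w) = r" by (simp add: r_def crit_root_def z)
  have g: "1 + 2 * w + 2 * r = joukowski w" by (simp add: joukowski_def r_def)
  have rp: "(2 * complex_of_real pi * of_nat n * r) powr (3/2) =
      of_real (real n * sqrt (real n)) * (of_real ((2 * pi) powr (3/2)) * r powr (3/2))" for n
  proof -
    have "2 * complex_of_real pi * of_nat n * r = of_real (real n) * (of_real (2 * pi) * r)" by (simp add: mult_ac)
    also have "\<dots> powr (3/2) = of_real (real n) powr (3/2) * (of_real (2 * pi) powr (3/2) * r powr (3/2))"
      by (subst powr_times_real_left, simp, simp, subst powr_times_real_left, simp_all)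
    also have "of_real (real n) powr (3/2) = complex_of_real (real n powr (3/2))"
      by (subst powr_of_real[symmetric]) auto
    also have "of_real (2 * pi) powr (3/2) = complex_of_real ((2 * pi) powr (3/2))"
      by (subst powr_of_real[symmetric]) auto
    also have "real n powr (3/2) = real n * sqrt (real n)"
    proof -
      have "real n powr (3/2) = real n powr (1 + 1/2)" by simp
      also have "\<dots> = real n * sqrt (real n)"
        by (subst powr_add) (simp add: powr_half_sqrt)
      finally show ?thesis .
    qed
    finally show ?thesis .
  qed
  show ?thesis unfolding w_def[symmetric] r g
  proof (rule asymp_equivI')
    have "(\<lambda>n. of_real (real n * sqrt (real n)) * poly (apery_poly n) z / joukowski w ^ (2 * n) / apery_limit_const w)
           \<longlonglongrightarrow> apery_limit_const w / apery_limit_const w"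
      unfolding z by (intro tendsto_divide apery_poly_limit w tendsto_const apery_limit_const_eq)
    moreover have "of_real (real n * sqrt (real n)) * poly (apery_poly n) z / joukowski w ^ (2 * n) / apery_limit_const w
        = poly (apery_poly n) z / ((1 + w + r)\<^sup>2 / (2 * (2 * complex_of_real pi * of_nat n * r) powr (3 / 2)) * joukowski w ^ (2 * n))" for n
      unfolding rp apery_limit_const_eq(1)[OF w] r_def[symmetric] by (simp add: mult_ac)
    ultimately show "(\<lambda>n. poly (apery_poly n) z / ((1 + w + r)\<^sup>2 / (2 * (2 * complex_of_real pi * of_nat n * r) powr (3 / 2)) * joukowski w ^ (2 * n))) \<longlonglongrightarrow> 1"
      using apery_limit_const_eq(2)[OF w] by simp
  qed
qed

theorem theorem4p1:
  shows "(\<forall>z::complex. z \<notin> \<real>\<^sub>\<le>\<^sub>0 \<longrightarrow>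
            (\<lambda>n. poly (apery_poly n) z) \<sim>[sequentially]
            (\<lambda>n. (1 + csqrt z + csqrt (z + csqrt z))\<^sup>2
                 / (2 * (2 * complex_of_real pi * of_nat n * csqrt (z + csqrt z)) powr (3 / 2))
                 * (1 + 2 * csqrt z + 2 * csqrt (z + csqrt z)) ^ (2 * n)))
       \<and> (\<lambda>n. poly (apery_poly n) 1) \<sim>[sequentially]
            (\<lambda>n. (1 + csqrt 2)\<^sup>2 / (2 * complex_of_real pi * csqrt 2 * of_nat n) powr (3 / 2)
                 * (1 + csqrt 2) ^ (4 * n))"
proof (intro conjI allI impI)
  show "(\<lambda>n. poly (apery_poly n) z) \<sim>[sequentially]
            (\<lambda>n. (1 + csqrt z + csqrt (z + csqrt z))\<^sup>2
                 / (2 * (2 * complex_of_real pi * of_nat n * csqrt (z + csqrt z)) powr (3 / 2))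
                 * (1 + 2 * csqrt z + 2 * csqrt (z + csqrt z)) ^ (2 * n))"
    if "z \<notin> \<real>\<^sub>\<le>\<^sub>0" for z
    using that by (rule apery_poly_asymp_equiv)
next
  define s where "s = csqrt 2"
  have s: "s\<^sup>2 = 2" unfolding s_def by (rule power2_csqrt)
  have "(1 :: complex) \<notin> \<real>\<^sub>\<le>\<^sub>0" by (simp add: complex_nonpos_Reals_iff)
  from apery_poly_asymp_equiv[OF this]
  have "(\<lambda>n. poly (apery_poly n) 1) \<sim>[sequentially]
      (\<lambda>n. (2 + s)\<^sup>2 / (2 * (2 * complex_of_real pi * of_nat n * s) powr (3 / 2)) * (3 + 2 * s) ^ (2 * n))"
    by (simp add: s_def)
  also have "(2 + s)\<^sup>2 = 2 * (1 + s)\<^sup>2" using s by (simp add: power2_eq_square algebra_simps)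
  also have "3 + 2 * s = (1 + s)\<^sup>2" using s by (simp add: power2_eq_square algebra_simps)
  finally show "(\<lambda>n. poly (apery_poly n) 1) \<sim>[sequentially]
      (\<lambda>n. (1 + csqrt 2)\<^sup>2 / (2 * complex_of_real pi * csqrt 2 * of_nat n) powr (3 / 2) * (1 + csqrt 2) ^ (4 * n))"
    unfolding s_def[symmetric] by (simp add: power_mult[symmetric] mult_ac)
qed

end
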